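(* Let $f$ be a rational map that is a non-Euclidean quadratic Thurston map with exactly four postcritical points, normalized so that $P_f=\{0,1,\infty,\bullet\}$ where $\bullet$ is statically trivial. Then there exists a quadratic Thurston map $g$ with exactly two or exactly three postcritical points such that $f=M_{\bullet,f(\bullet)}\circ g$.
   Context: A Thurston map is an orientation-preserving branched cover $f:\mathbb S^2\to\mathbb S^2$ of degree $\ge2$ with finite postcritical set $P_f=\bigcup_{i>0}f^{\circ i}(C_f)$, $C_f$ the set of critical points; quadratic means degree 2. $f$ is Euclidean if its orbifold Euler characteristic is zero; a quadratic Thurston map with four postcritical points is Euclidean iff it has no periodic critical point. A point $y\in P_f$ is statically trivial if $f^{-1}(f(y))$ contains no critical point and no point of $P_f$ other than $y$. For $\bullet\in\widehat{\mathbb C}\setminus\{0,1,\infty\}$, $M_{\bullet,0},M_{\bullet,1},M_{\bullet,\infty}$ denote the Möbius transformations inducing on $\{0,1,\infty,\bullet\}$ the permutations $(\bullet\;0)(1\;\infty)$, $(\bullet\;1)(0\;\infty)$, $(\bullet\;\infty)(0\;1)$ respectively. *)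

theory Defs
  imports
    "HOL-Complex_Analysis.Complex_Analysis"
    "HOL-Computational_Algebra.Computational_Algebra"
begin

(* The 2-sphere is the one-point compactification of the complex plane, with None as the point
   at infinity; it carries the orientation of the Riemann sphere. *)

type_synonym csphere = "complex option"

abbreviation sphere_top :: "csphere topology"
  where "sphere_top \<equiv> Alexandroff_compactification euclidean"

abbreviation infinity :: csphere  ("\<infinity>\<^sub>S")
  where "\<infinity>\<^sub>S \<equiv> None"

(* Inverse of the holomorphic coordinate 1/z at infinity. *)

definition chart_at_infinity :: "complex \<Rightarrow> csphere"
  where "chart_at_infinity z = (if z = 0 then \<infinity>\<^sub>S else Some (inverse z))"

(* For an injective continuous map h from an open U into the plane: h carries every
   positively oriented round circle bounding a disc in U, read in either of the two standard
   holomorphic coordinates, to a loop that winds once, positively, around the image of the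
   centre. *)

definition orientation_preserving_on :: "csphere set \<Rightarrow> (csphere \<Rightarrow> complex) \<Rightarrow> bool"
  where "orientation_preserving_on U h \<longleftrightarrow>
    (\<forall>c \<in> {Some, chart_at_infinity}. \<forall>z r. r > 0 \<and> c ` cball z r \<subseteq> U \<longrightarrow>
       winding_number (h \<circ> c \<circ> circlepath z r) (h (c z)) = 1)"

definition oriented_disc_chart :: "csphere \<Rightarrow> csphere set \<Rightarrow> (csphere \<Rightarrow> complex) \<Rightarrow> bool"
  where "oriented_disc_chart x U h \<longleftrightarrow>
    openin sphere_top U \<and> x \<in> U \<and>
    homeomorphic_map (subtopology sphere_top U) (top_of_set (ball 0 1)) h \<and>
    h x = 0 \<and> orientation_preserving_on U h"

definition has_local_degree :: "(csphere \<Rightarrow> csphere) \<Rightarrow> csphere \<Rightarrow> nat \<Rightarrow> bool"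
  where "has_local_degree f x d \<longleftrightarrow> d \<ge> 1 \<and>
    (\<exists>U V \<phi> \<psi>. oriented_disc_chart x U \<phi> \<and> oriented_disc_chart (f x) V \<psi> \<and>
       f ` U \<subseteq> V \<and> (\<forall>y\<in>U. \<psi> (f y) = \<phi> y ^ d))"

definition branched_cover :: "(csphere \<Rightarrow> csphere) \<Rightarrow> bool"
  where "branched_cover f \<longleftrightarrow>
    continuous_map sphere_top sphere_top f \<and> (\<forall>x. \<exists>d. has_local_degree f x d)"

definition local_degree :: "(csphere \<Rightarrow> csphere) \<Rightarrow> csphere \<Rightarrow> nat"
  where "local_degree f x = (THE d. has_local_degree f x d)"

(* Number of preimages of any point, counted with multiplicity.  Fibres of a branched cover
   of the sphere are finite, by compactness. *)

definition cover_degree :: "(csphere \<Rightarrow> csphere) \<Rightarrow> nat"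
  where "cover_degree f = (THE d. \<forall>y. (\<Sum>x | f x = y. local_degree f x) = d)"

definition critical_points :: "(csphere \<Rightarrow> csphere) \<Rightarrow> csphere set"
  where "critical_points f = {x. local_degree f x \<ge> 2}"

definition postcritical_set :: "(csphere \<Rightarrow> csphere) \<Rightarrow> csphere set"
  where "postcritical_set f = (\<Union>i\<in>{0<..}. (f ^^ i) ` critical_points f)"

definition thurston_map :: "(csphere \<Rightarrow> csphere) \<Rightarrow> bool"
  where "thurston_map f \<longleftrightarrow>
    branched_cover f \<and> cover_degree f \<ge> 2 \<and> finite (postcritical_set f)"

definition quadratic_thurston_map :: "(csphere \<Rightarrow> csphere) \<Rightarrow> bool"
  where "quadratic_thurston_map f \<longleftrightarrow> thurston_map f \<and> cover_degree f = 2"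

(* Ramification function of the orbifold.  The weight infinity is encoded as 0: on nat, the Lcm
   of an infinite set is 0.  With 1 / 0 = 0 such a point then contributes 1 to the sum in
   the Euler characteristic, as it should. *)

definition orbifold_weight :: "(csphere \<Rightarrow> csphere) \<Rightarrow> csphere \<Rightarrow> nat"
  where "orbifold_weight f x = Lcm {local_degree (f ^^ n) y |n y. n \<ge> 1 \<and> (f ^^ n) y = x}"

definition orbifold_euler_char :: "(csphere \<Rightarrow> csphere) \<Rightarrow> real"
  where "orbifold_euler_char f =
    2 - (\<Sum>x\<in>postcritical_set f. 1 - 1 / real (orbifold_weight f x))"

definition euclidean_thurston_map :: "(csphere \<Rightarrow> csphere) \<Rightarrow> bool"
  where "euclidean_thurston_map f \<longleftrightarrow> thurston_map f \<and> orbifold_euler_char f = 0"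

definition statically_trivial :: "(csphere \<Rightarrow> csphere) \<Rightarrow> csphere \<Rightarrow> bool"
  where "statically_trivial f y \<longleftrightarrow> y \<in> postcritical_set f \<and>
    f -` {f y} \<inter> critical_points f = {} \<and> f -` {f y} \<inter> postcritical_set f \<subseteq> {y}"

(* The map p/q for coprime p and q; the value at infinity is the ratio of the coefficients in
   degree max (degree p) (degree q), which do not both vanish. *)

definition rational_fun :: "complex poly \<Rightarrow> complex poly \<Rightarrow> csphere \<Rightarrow> csphere"
  where "rational_fun p q x =
    (case x of
       Some z \<Rightarrow> if poly q z = 0 then \<infinity>\<^sub>S else Some (poly p z / poly q z)
     | None \<Rightarrow> let n = max (degree p) (degree q) in
         if coeff q n = 0 then \<infinity>\<^sub>S else Some (coeff p n / coeff q n))"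

definition rational_map :: "(csphere \<Rightarrow> csphere) \<Rightarrow> bool"
  where "rational_map f \<longleftrightarrow> (\<exists>p q. q \<noteq> 0 \<and> coprime p q \<and> f = rational_fun p q)"

definition moebius :: "(csphere \<Rightarrow> csphere) \<Rightarrow> bool"
  where "moebius M \<longleftrightarrow>
    (\<exists>a b c d. a * d - b * c \<noteq> 0 \<and> M = rational_fun [:b, a:] [:d, c:])"

(* The Moebius transformation inducing the permutation (a b)(c d). *)

definition moebius_double_swap ::
    "csphere \<Rightarrow> csphere \<Rightarrow> csphere \<Rightarrow> csphere \<Rightarrow> csphere \<Rightarrow> csphere"
  where "moebius_double_swap a b c d =
    (THE M. moebius M \<and> M a = b \<and> M b = a \<and> M c = d \<and> M d = c)"

definition moebius_M :: "csphere \<Rightarrow> csphere \<Rightarrow> csphere \<Rightarrow> csphere"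
  where "moebius_M p w =
    (if w = Some 0 then moebius_double_swap p (Some 0) (Some 1) \<infinity>\<^sub>S
     else if w = Some 1 then moebius_double_swap p (Some 1) (Some 0) \<infinity>\<^sub>S
     else if w = \<infinity>\<^sub>S then moebius_double_swap p \<infinity>\<^sub>S (Some 0) (Some 1)
     else undefined)"

end

theory Submission
  imports
    Defs
    "HOL-Computational_Algebra.Field_as_Ring"
begin

text \<open>
  Write \<open>M\<close> for the Moebius transformation exchanging \<open>p\<close> with \<open>f p\<close> and the other two
  postcritical points with each other, \<open>N\<close> for its inverse, and put \<open>g = N \<circ> f\<close>, so that
  \<open>f = M \<circ> g\<close>.  Composing with a homeomorphism that respects the orientation changes neither the
  critical points nor the degree, so \<open>g\<close> is a quadratic branched cover with the critical points of
  \<open>f\<close>.  As \<open>N\<close> permutes the postcritical set of \<open>f\<close>, that set contains the postcritical set of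
  \<open>g\<close>.  Moreover \<open>g x = p\<close> means \<open>f x = f p\<close>; static triviality says that no critical point and
  no postcritical point other than \<open>p\<close> has this property, so an orbit of \<open>g\<close> starting at a critical
  value never reaches \<open>p\<close>.  Hence the postcritical set of \<open>g\<close> is contained in \<open>{0, 1, \<infinity>}\<close> and has
  at most three points.  It has at least two because a quadratic rational map has two distinct
  critical values.

  Two parts of this need real work.  The first is the invariance of local degrees
  (\<open>has_local_degree_conformal_compose\<close>).  Orientation is defined through winding numbers of images
  of round circles, and a Moebius transformation does not respect their centres; the remedy is to
  shrink a circle and to deform its image into a round one (\<open>winding_number_twisted_circle\<close>).

  The second is the existence of two critical values, which has to be extracted from the
  topological degree.  The local degree counts preimages of nearby points
  (\<open>has_local_degree_card_nearby\<close>); compactness turns this into a count of whole fibres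
  (\<open>sum_local_degree_fibre\<close>), and comparison with a generic fibre of \<open>p/q\<close> identifies the
  topological with the algebraic degree.  In degree 2 the critical values are the points with only
  one preimage, that is, the zeros of the discriminant of \<open>v p - u q\<close> as a quadratic form in
  \<open>(u, v)\<close>.  Two distinct zeros exist because the discriminant of that form is a multiple of the
  resultant of \<open>p\<close> and \<open>q\<close> (\<open>quadratic_rational_singleton_fibres\<close>).
\<close>

section \<open>Homogeneous coordinates and the two charts\<close>

text \<open>
  The point with homogeneous coordinates \<open>[u : v]\<close>; it is a genuine point of the projective line
  only when \<open>u\<close> and \<open>v\<close> do not both vanish.  Both charts, Moebius transformations and the fibres
  of rational maps take one uniform form in these coordinates, without a case for infinity.
\<close>

definition hpoint :: "complex \<Rightarrow> complex \<Rightarrow> csphere"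
  where "hpoint u v = (if v = 0 then \<infinity>\<^sub>S else Some (u / v))"

lemma hpoint_eq_iff:
  assumes "u \<noteq> 0 \<or> v \<noteq> 0" "u' \<noteq> 0 \<or> v' \<noteq> 0"
  shows "hpoint u v = hpoint u' v' \<longleftrightarrow> u * v' = u' * v"
  using assms by (auto simp: hpoint_def field_simps)

lemma hpoint_cases:
  obtains u v where "u \<noteq> 0 \<or> v \<noteq> 0" "x = hpoint u v"
proof (cases x)
  case None
  then show ?thesis using that[of 1 0] by (simp add: hpoint_def)
next
  case (Some z)
  then show ?thesis using that[of z 1] by (simp add: hpoint_def)
qed

abbreviation charts :: "(complex \<Rightarrow> csphere) set"
  where "charts \<equiv> {Some, chart_at_infinity}"

lemma Some_eq_hpoint: "Some z = hpoint z 1"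
  by (simp add: hpoint_def)

lemma chart_at_infinity_eq_hpoint: "chart_at_infinity z = hpoint 1 z"
  by (simp add: hpoint_def chart_at_infinity_def field_simps)

lemma inj_chart: "c \<in> charts \<Longrightarrow> inj c"
  by (auto simp: inj_def chart_at_infinity_eq_hpoint hpoint_eq_iff)

lemma in_chart: obtains c z where "c \<in> charts" "x = c z"
proof (cases x)
  case None
  then show ?thesis using that[of chart_at_infinity 0] by (simp add: chart_at_infinity_def)
qed (use that in blast)

lemma topspace_sphere: "topspace sphere_top = UNIV"
  by (simp add: UNIV_option_conv)

text \<open>
  The only delicate open sets are the neighbourhoods of infinity, the complements of compact
  sets \<open>C\<close>.  Since \<open>C\<close> lies in some disc of radius \<open>R\<close>, its inverse image under \<open>1/z\<close> stays at
  distance at least \<open>1/R\<close> from the singularity 0 and is therefore closed.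
\<close>

lemma continuous_map_chart_at_infinity: "continuous_map euclidean sphere_top chart_at_infinity"
  unfolding continuous_map_def
proof (intro conjI allI impI)
  fix V assume V: "openin sphere_top V"
  then consider U where "open U" "V = Some ` U"
    | C where "compact C" "V = insert \<infinity>\<^sub>S (Some ` (- C))"
    by (auto simp: openin_Alexandroff_compactification Compl_eq_Diff_UNIV)
  then have "open (chart_at_infinity -` V)"
  proof cases
    case 1
    have "open ((- {0}) \<inter> inverse -` U)"
      using 1 by (intro continuous_open_preimage continuous_on_inverse continuous_on_id) auto
    also have "(- {0}) \<inter> inverse -` U = chart_at_infinity -` V"
      using 1 by (auto simp: chart_at_infinity_def split: if_splits)
    finally show ?thesis .
  next
    case 2
    obtain R where R: "R > 0" "\<And>x. x \<in> C \<Longrightarrow> norm x \<le> R"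
      using compact_imp_bounded[OF 2(1)] bounded_pos by metis
    have "closed ((- ball 0 (1/R)) \<inter> inverse -` C)"
      using 2 R(1) compact_imp_closed
      by (intro continuous_closed_preimage) (auto intro!: continuous_on_inverse continuous_on_id simp: closed_Compl)
    moreover have "(- ball 0 (1/R)) \<inter> inverse -` C = - (chart_at_infinity -` V)" (is "?L = ?R")
    proof
      show "?L \<subseteq> ?R"
        using 2 R(1) by (auto simp: chart_at_infinity_def split: if_splits)
      show "?R \<subseteq> ?L"
      proof
        fix x assume "x \<in> ?R"
        then have x: "x \<noteq> 0" "inverse x \<in> C"
          using 2 by (auto simp: chart_at_infinity_def split: if_splits)
        then have "1 / norm x \<le> R" using R(2)[OF x(2)] by (simp add: norm_inverse divide_inverse)
        then have "norm x \<ge> 1 / R" using R(1) x(1) by (simp add: field_simps)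
        then show "x \<in> ?L" using x by simp
      qed
    qed
    ultimately show ?thesis by (metis open_closed)
  qed
  then show "openin euclidean {x \<in> topspace euclidean. chart_at_infinity x \<in> V}"
    by (simp add: vimage_def)
qed (simp add: topspace_sphere del: topspace_Alexandroff_compactification)

lemma continuous_map_chart: "c \<in> charts \<Longrightarrow> continuous_map euclidean sphere_top c"
  using continuous_map_Some continuous_map_chart_at_infinity by auto

lemma open_vimage_chart:
  assumes "c \<in> charts" "openin sphere_top V" shows "open (c -` V)"
  using openin_continuous_map_preimage[OF continuous_map_chart[OF assms(1)] assms(2)]
  by (simp add: vimage_def)

text \<open>
  The two charts generate the topology of the sphere, so that openness and continuity can be
  tested in coordinates.  An open set around infinity contains the image of a small disc under
  \<open>1/z\<close>; its complement is thus bounded and closed, hence compact.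
\<close>

lemma openin_sphere_iff:
  "openin sphere_top V \<longleftrightarrow> (\<forall>c\<in>charts. open (c -` V))" (is "?L \<longleftrightarrow> ?R")
proof
  assume R: ?R
  show ?L
  proof (cases "\<infinity>\<^sub>S \<in> V")
    case False
    then have "V = Some ` (Some -` V)"
      by (auto simp: image_vimage_eq) (metis not_None_eq rangeI)
    moreover have "openin sphere_top (Some ` (Some -` V))"
      using R by (simp del: image_vimage_eq)
    ultimately show ?thesis by simp
  next
    case True
    have "0 \<in> chart_at_infinity -` V" using True by (simp add: chart_at_infinity_def)
    then obtain e where e: "e > 0" "ball 0 e \<subseteq> chart_at_infinity -` V"
      using R open_contains_ball by blast
    have "bounded (- (Some -` V))"
    proof (rule boundedI)
      fix z assume z: "z \<in> - (Some -` V)"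
      show "norm z \<le> 1 / e"
      proof (rule ccontr)
        assume "\<not> norm z \<le> 1 / e"
        then have n: "norm z > 1 / e" by simp
        then have "z \<noteq> 0" using e(1) by (auto simp: divide_less_0_iff)
        then have "inverse z \<in> ball 0 e" using n e(1) by (simp add: norm_inverse norm_divide field_simps)
        then have "chart_at_infinity (inverse z) \<in> V" using e(2) by auto
        then show False using z \<open>z \<noteq> 0\<close> by (simp add: chart_at_infinity_def)
      qed
    qed
    moreover have "closed (- (Some -` V))" using R by (simp add: closed_Compl)
    ultimately have "compact (- (Some -` V))" by (simp add: compact_eq_bounded_closed)
    moreover have "V = insert \<infinity>\<^sub>S (Some ` (topspace euclidean - (- (Some -` V))))"
    proof (rule set_eqI)
      fix x show "x \<in> V \<longleftrightarrow> x \<in> insert \<infinity>\<^sub>S (Some ` (topspace euclidean - (- (Some -` V))))"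
        using True by (cases x) auto
    qed
    ultimately have "\<exists>C. compactin euclidean C \<and> closedin euclidean C \<and>
        V = insert \<infinity>\<^sub>S (Some ` (topspace euclidean - C))"
      using compact_imp_closed
      by (intro exI[of _ "- (Some -` V)"]) (simp del: topspace_euclidean Compl_iff)
    then show ?thesis unfolding openin_Alexandroff_compactification by (rule disjI2)
  qed
qed (use open_vimage_chart in blast)

lemma infinite_open_sphere:
  assumes "openin sphere_top V" "x \<in> V" shows "infinite V"
proof
  assume "finite V"
  obtain c z where c: "c \<in> charts" "x = c z" by (rule in_chart)
  have "finite (c -` V)" using \<open>finite V\<close> inj_chart[OF c(1)] by (simp add: finite_vimageI)
  moreover have "open (c -` V)" "z \<in> c -` V" using open_vimage_chart c assms by auto
  ultimately show False using finite_imp_not_open by blast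
qed

lemma Hausdorff_sphere: "Hausdorff_space sphere_top"
  by (simp add: Hausdorff_space_Alexandroff_compactification
      locally_compact_space_euclidean Hausdorff_space_euclidean)

section \<open>Moebius transformations as conformal maps\<close>

text \<open>
  A self-map of the sphere that, read in suitable charts, is differentiable with non-zero
  derivative at every point.  This is Caratheodory's form of differentiability: \<open>B\<close> is the
  difference quotient of the map at \<open>z\<close>, with the derivative as its value at \<open>z\<close>.  That \<open>B\<close> is
  continuous and has no zeros on a whole disc is just what a homotopy between the image of a small
  circle and a round circle needs.
\<close>

definition conformal :: "(csphere \<Rightarrow> csphere) \<Rightarrow> bool"
  where "conformal T \<longleftrightarrow> (\<forall>c\<in>charts. \<forall>z. \<exists>c'\<in>charts. \<exists>a B \<delta>. \<delta> > 0 \<and>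
    continuous_on (cball z \<delta>) B \<and>
    (\<forall>w\<in>cball z \<delta>. B w \<noteq> 0 \<and> T (c w) = c' (a + (w - z) * B w)))"

lemma conformal_imp_continuous:
  assumes "conformal T" shows "continuous_map sphere_top sphere_top T"
  unfolding continuous_map_def
proof (intro conjI allI impI)
  fix V assume V: "openin sphere_top V"
  have "open (c -` (T -` V))" if c: "c \<in> charts" for c
  proof (subst open_subopen, intro ballI)
    fix z assume z: "z \<in> c -` (T -` V)"
    obtain c' a B \<delta> where c': "c' \<in> charts" "\<delta> > 0" "continuous_on (cball z \<delta>) B"
      "\<And>w. w \<in> cball z \<delta> \<Longrightarrow> T (c w) = c' (a + (w - z) * B w)"
      using assms c unfolding conformal_def by meson
    have "continuous_on (ball z \<delta>) B"
      using c'(3) by (rule continuous_on_subset) auto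
    then have "open (ball z \<delta> \<inter> (\<lambda>w. a + (w - z) * B w) -` (c' -` V))"
      by (intro continuous_open_preimage open_vimage_chart[OF c'(1) V] continuous_intros open_ball)
    moreover have "z \<in> ball z \<delta> \<inter> (\<lambda>w. a + (w - z) * B w) -` (c' -` V)"
      using z c'(2) c'(4)[of z] by auto
    moreover have "ball z \<delta> \<inter> (\<lambda>w. a + (w - z) * B w) -` (c' -` V) \<subseteq> c -` (T -` V)"
      using c'(4) by auto
    ultimately show "\<exists>S. open S \<and> z \<in> S \<and> S \<subseteq> c -` (T -` V)" by blast
  qed
  then have "openin sphere_top (T -` V)" unfolding openin_sphere_iff by blast
  moreover have "T -` V = {x \<in> topspace sphere_top. T x \<in> V}"
    unfolding topspace_sphere by blast
  ultimately show "openin sphere_top {x \<in> topspace sphere_top. T x \<in> V}" by simp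
qed (simp add: topspace_sphere del: topspace_Alexandroff_compactification)

definition mob :: "complex \<Rightarrow> complex \<Rightarrow> complex \<Rightarrow> complex \<Rightarrow> csphere \<Rightarrow> csphere"
  where "mob a b c d x = (case x of None \<Rightarrow> hpoint a c | Some z \<Rightarrow> hpoint (a * z + b) (c * z + d))"

lemma linear_nonzero:
  fixes a :: complex
  assumes "a * d - b * c \<noteq> 0" "u \<noteq> 0 \<or> v \<noteq> 0"
  shows "a * u + b * v \<noteq> 0 \<or> c * u + d * v \<noteq> 0"
proof (rule ccontr)
  assume "\<not> ?thesis"
  then have *: "a * u + b * v = 0" "c * u + d * v = 0" by blast+
  have "(a * d - b * c) * u = 0" "(a * d - b * c) * v = 0"
  proof -
    have "(a * d - b * c) * u = d * (a * u + b * v) - b * (c * u + d * v)"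
      "(a * d - b * c) * v = a * (c * u + d * v) - c * (a * u + b * v)"
      by (simp_all add: algebra_simps)
    then show "(a * d - b * c) * u = 0" "(a * d - b * c) * v = 0" using * by simp_all
  qed
  then show False using assms by auto
qed

text \<open>
  The matrix acts linearly on homogeneous coordinates; inverses then reduce to the adjugate
  matrix.
\<close>

lemma mob_hpoint:
  assumes "a * d - b * c \<noteq> 0" "u \<noteq> 0 \<or> v \<noteq> 0"
  shows "mob a b c d (hpoint u v) = hpoint (a * u + b * v) (c * u + d * v)"
proof (cases "v = 0")
  case True
  then show ?thesis using assms by (auto simp: mob_def hpoint_def)
next
  case False
  define s where "s = u / v"
  have u: "u = s * v" and s: "s \<noteq> 0 \<or> (1::complex) \<noteq> 0" using False by (simp_all add: s_def)
  have "mob a b c d (hpoint u v) = hpoint (a * s + b * 1) (c * s + d * 1)"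
    using False by (simp add: mob_def hpoint_def s_def)
  also have "\<dots> = hpoint (a * u + b * v) (c * u + d * v)"
    by (subst hpoint_eq_iff[OF linear_nonzero[OF assms(1) s] linear_nonzero[OF assms]])
      (simp add: u algebra_simps)
  finally show ?thesis .
qed

lemma mob_inverse:
  assumes "a * d - b * c \<noteq> 0"
  shows "mob d (- b) (- c) a (mob a b c d x) = x"
proof -
  obtain u v where uv: "u \<noteq> 0 \<or> v \<noteq> 0" "x = hpoint u v" by (rule hpoint_cases)
  have det: "d * a - (- b) * (- c) \<noteq> 0" using assms by (simp add: algebra_simps)
  show ?thesis unfolding uv(2) mob_hpoint[OF assms uv(1)]
      mob_hpoint[OF det linear_nonzero[OF assms uv(1)]]
    by (subst hpoint_eq_iff[OF linear_nonzero[OF det linear_nonzero[OF assms uv(1)]] uv(1)])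
      (auto simp: algebra_simps)
qed

lemma rational_fun_linear:
  assumes "a * d - b * c \<noteq> 0"
  shows "rational_fun [:b, a:] [:d, c:] = mob a b c d"
proof
  fix x
  have "max (degree [:b, a:]) (degree [:d, c:]) = 1" using assms by auto
  then show "rational_fun [:b, a:] [:d, c:] x = mob a b c d x"
    by (cases x) (auto simp: rational_fun_def mob_def hpoint_def Let_def algebra_simps)
qed

lemma moebius_iff_mob: "moebius M \<longleftrightarrow> (\<exists>a b c d. a * d - b * c \<noteq> 0 \<and> M = mob a b c d)"
  unfolding moebius_def by (metis rational_fun_linear)

text \<open>
  Away from the pole the difference quotient is \<open>(ad - bc) / ((cw + d)(cz + d))\<close>; at the pole the
  chart at infinity shows the reciprocal map, whose difference quotient is \<open>c / (aw + b)\<close>.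
\<close>

lemma mob_local_form:
  assumes det: "a * d - b * c \<noteq> 0"
  shows "\<exists>c'\<in>charts. \<exists>e B \<delta>. \<delta> > 0 \<and> continuous_on (cball z \<delta>) B \<and>
    (\<forall>w\<in>cball z \<delta>. B w \<noteq> 0 \<and> mob a b c d (Some w) = c' (e + (w - z) * B w))"
proof (cases "c * z + d = 0")
  case False
  have "open {w. c * w + d \<noteq> 0}" by (intro open_Collect_neq continuous_intros)
  then obtain \<delta> where \<delta>: "\<delta> > 0" "cball z \<delta> \<subseteq> {w. c * w + d \<noteq> 0}"
    using False unfolding open_contains_cball by blast
  define B where "B w = (a * d - b * c) / ((c * w + d) * (c * z + d))" for w
  have "continuous_on (cball z \<delta>) B" unfolding B_def
    using \<delta>(2) False by (intro continuous_intros) auto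
  moreover have "B w \<noteq> 0 \<and> mob a b c d (Some w) = Some ((a * z + b) / (c * z + d) + (w - z) * B w)"
    if "w \<in> cball z \<delta>" for w
  proof -
    have "c * w + d \<noteq> 0" using that \<delta> by auto
    then have "(a * w + b) / (c * w + d) - (a * z + b) / (c * z + d) = (w - z) * B w"
      using False unfolding B_def
      by (simp add: diff_frac_eq) (simp add: algebra_simps)
    then have "(a * w + b) / (c * w + d) = (a * z + b) / (c * z + d) + (w - z) * B w"
      by (simp add: diff_eq_eq add.commute)
    moreover have "B w \<noteq> 0" using False det \<open>c * w + d \<noteq> 0\<close> by (simp add: B_def)
    ultimately show ?thesis using \<open>c * w + d \<noteq> 0\<close> by (simp add: mob_def hpoint_def)
  qed
  ultimately show ?thesis using \<delta>(1) by blast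
next
  case True
  have nz: "a * z + b \<noteq> 0" using linear_nonzero[OF det, of z 1] True by auto
  have "c \<noteq> 0" using True det by auto
  have "open {w. a * w + b \<noteq> 0}" by (intro open_Collect_neq continuous_intros)
  then obtain \<delta> where \<delta>: "\<delta> > 0" "cball z \<delta> \<subseteq> {w. a * w + b \<noteq> 0}"
    using nz unfolding open_contains_cball by blast
  define B where "B w = c / (a * w + b)" for w
  have "continuous_on (cball z \<delta>) B" unfolding B_def
    using \<delta>(2) by (intro continuous_intros) auto
  moreover have "B w \<noteq> 0 \<and> mob a b c d (Some w) = chart_at_infinity (0 + (w - z) * B w)"
    if "w \<in> cball z \<delta>" for w
  proof -
    have nz: "a * w + b \<noteq> 0" using that \<delta> by auto
    have "(w - z) * c = c * w + d" using True by (simp add: algebra_simps add_eq_0_iff)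
    then have "0 + (w - z) * B w = (c * w + d) / (a * w + b)" by (simp add: B_def)
    then show ?thesis using nz \<open>c \<noteq> 0\<close>
      by (simp add: mob_def hpoint_eq_iff chart_at_infinity_eq_hpoint B_def)
  qed
  ultimately show ?thesis using \<delta>(1) by blast
qed

text \<open>
  Precomposition with \<open>1/z\<close> swaps the columns of the matrix, so the chart at infinity in the
  domain needs no separate computation.
\<close>

lemma conformal_mob:
  assumes "a * d - b * c \<noteq> 0" shows "conformal (mob a b c d)"
proof -
  have eq: "mob a b c d (chart_at_infinity w) = mob b a d c (Some w)" for w
    using assms
    by (simp add: chart_at_infinity_eq_hpoint Some_eq_hpoint mob_hpoint algebra_simps)
  have "b * c - a * d \<noteq> 0" using assms by (simp add: algebra_simps)
  then show ?thesis unfolding conformal_def using mob_local_form[OF assms] mob_local_form[of b c a d]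
    by (simp only: eq ball_simps) blast
qed

lemma moebius_conformal_inverse:
  assumes "moebius M"
  obtains N where "conformal M" "conformal N" "\<And>x. N (M x) = x" "\<And>x. M (N x) = x"
proof -
  obtain a b c d where M: "a * d - b * c \<noteq> 0" "M = mob a b c d"
    using assms moebius_iff_mob by blast
  have d: "d * a - (- b) * (- c) \<noteq> 0" using M(1) by (simp add: algebra_simps)
  show ?thesis
    using that[of "mob d (-b) (-c) a"] conformal_mob[OF M(1)] conformal_mob[OF d]
      mob_inverse[OF M(1)] mob_inverse[OF d] M(2) by simp
qed

section \<open>Local degrees are invariant under conformal changes of the target\<close>

lemma dist_circlepath: "r \<ge> 0 \<Longrightarrow> dist z (circlepath z r t) = r"
  by (simp add: dist_norm circlepath norm_mult norm_exp_eq_Re)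

text \<open>
  Shrinking the circle is a homotopy of its image that misses the image of the centre, as \<open>h\<close> is
  injective.  Hence only arbitrarily small circles matter for the orientation.
\<close>

lemma winding_number_circle_radius:
  assumes h: "continuous_on (cball z r) h" "inj_on h (cball z r)" and \<rho>: "0 < \<rho>" "\<rho> \<le> r"
  shows "winding_number (h \<circ> circlepath z r) (h z) = winding_number (h \<circ> circlepath z \<rho>) (h z)"
proof (rule winding_number_homotopic_loops)
  define R where "R s = (1 - s) * r + s * \<rho>" for s :: real
  have R: "0 < R s \<and> R s \<le> r" if "s \<in> {0..1}" for s
  proof -
    have "R s \<le> r" using \<rho> that mult_left_mono[of \<rho> r s] by (simp add: R_def algebra_simps)
    moreover have "R s \<ge> (1 - s) * \<rho> + s * \<rho>"
      using \<rho> that mult_left_mono[of \<rho> r "1 - s"] by (simp add: R_def)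
    ultimately show ?thesis using \<rho> by (simp add: algebra_simps)
  qed
  show "homotopic_loops (- {h z}) (h \<circ> circlepath z r) (h \<circ> circlepath z \<rho>)"
    unfolding homotopic_loops
  proof (intro exI[where x = "\<lambda>(s, t). h (circlepath z (R s) t)"] conjI ballI)
    have "continuous_on ({0..1::real} \<times> {0..1::real}) (h \<circ> (\<lambda>x. circlepath z (R (fst x)) (snd x)))"
    proof (rule continuous_on_compose)
      show "continuous_on ({0..1} \<times> {0..1}) (\<lambda>x. circlepath z (R (fst x)) (snd x))"
        unfolding circlepath R_def by (intro continuous_intros)
      show "continuous_on ((\<lambda>x. circlepath z (R (fst x)) (snd x)) ` ({0..1} \<times> {0..1})) h"
        by (rule continuous_on_subset[OF h(1)]) (use R in \<open>force simp: dist_circlepath less_imp_le\<close>)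
    qed
    then show "continuous_on ({0..1::real} \<times> {0..1::real}) (\<lambda>(s, t). h (circlepath z (R s) t))"
      by (simp add: case_prod_beta o_def)
    show "(\<lambda>(s, t). h (circlepath z (R s) t)) \<in> {0..1} \<times> {0..1} \<rightarrow> - {h z}"
    proof clarify
      fix s t :: real assume s: "s \<in> {0..1}" and eq: "h (circlepath z (R s) t) = h z"
      have "circlepath z (R s) t = z"
        by (rule inj_onD[OF h(2) eq]) (use R[OF s] in \<open>auto simp: dist_circlepath\<close>)
      then show False using R[OF s] dist_circlepath[of "R s" z t] by simp
    qed
  qed (auto simp: R_def pathfinish_def pathstart_def circlepath)
qed

text \<open>
  A zero-free continuous \<open>B\<close> on a disc is \<open>exp \<beta>\<close>.  Scaling \<open>\<beta>\<close> down to 0 deforms the loop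
  \<open>a + (w - z) B(w)\<close>, for \<open>w\<close> on a small circle around \<open>z\<close>, into a round circle around \<open>a\<close>
  without meeting \<open>a\<close>.  Applying the injective map \<open>k\<close> keeps the loops away from \<open>k a\<close>.
\<close>

lemma winding_number_twisted_circle:
  fixes k B :: "complex \<Rightarrow> complex"
  assumes k: "continuous_on (ball a \<epsilon>) k" "inj_on k (ball a \<epsilon>)" "\<epsilon> > 0"
    and w1: "\<And>\<rho>. 0 < \<rho> \<Longrightarrow> \<rho> < \<epsilon> \<Longrightarrow> winding_number (k \<circ> circlepath a \<rho>) (k a) = 1"
    and B: "continuous_on (cball z \<delta>) B" "\<And>w. w \<in> cball z \<delta> \<Longrightarrow> B w \<noteq> 0" "\<delta> > 0"
  obtains \<rho> where "0 < \<rho>" "\<rho> \<le> \<delta>"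
    "winding_number (k \<circ> (\<lambda>w. a + (w - z) * B w) \<circ> circlepath z \<rho>) (k a) = 1"
proof -
  obtain \<beta> where \<beta>: "continuous_on (cball z \<delta>) \<beta>" "\<And>w. w \<in> cball z \<delta> \<Longrightarrow> B w = exp (\<beta> w)"
    using continuous_logarithm_on_cball[OF B(1,2)] by metis
  have "bounded (\<beta> ` cball z \<delta>)"
    using compact_continuous_image[OF \<beta>(1) compact_cball] compact_imp_bounded by blast
  then obtain K where K: "K > 0" "\<And>w. w \<in> cball z \<delta> \<Longrightarrow> norm (\<beta> w) \<le> K"
    using bounded_pos by (metis imageI)
  \<comment> \<open>Along the homotopy the factor is at most \<open>exp K\<close> in modulus, so this radius keeps it in the
     disc on which \<open>k\<close> is defined.\<close>
  define \<rho> where "\<rho> = min \<delta> (\<epsilon> / (2 * exp K))"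
  have \<rho>: "0 < \<rho>" "\<rho> \<le> \<delta>" using B(3) k(3) by (auto simp: \<rho>_def)
  have "\<rho> * exp K \<le> \<epsilon> / (2 * exp K) * exp K"
    by (rule mult_right_mono) (auto simp: \<rho>_def)
  then have \<rho>K: "\<rho> * exp K < \<epsilon>" using k(3) by simp
  have "\<rho> * 1 \<le> \<rho> * exp K" using \<rho>(1) K(1) by (intro mult_left_mono) auto
  then have \<rho>\<epsilon>: "\<rho> < \<epsilon>" using \<rho>K by simp
  define H where "H s t = a + (circlepath z \<rho> t - z) * exp (of_real (1 - s) * \<beta> (circlepath z \<rho> t))"
    for s t :: real
  have in_cb: "circlepath z \<rho> t \<in> cball z \<delta>" for t
    using \<rho> by (simp add: dist_circlepath)
  have H: "H s t \<in> ball a \<epsilon> - {a}" if "s \<in> {0..1}" for s t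
  proof -
    let ?e = "exp (of_real (1 - s) * \<beta> (circlepath z \<rho> t))"
    have "norm (of_real (1 - s) * \<beta> (circlepath z \<rho> t)) \<le> 1 * K"
      unfolding norm_mult using that K(2)[OF in_cb[of t]]
      by (intro mult_mono) (auto simp del: of_real_diff)
    then have "norm ?e \<le> exp K" 
      by (metis norm_exp exp_le_cancel_iff order_trans mult_1)
    moreover have "norm (circlepath z \<rho> t - z) = \<rho>"
      using dist_circlepath[of \<rho> z t] \<rho>(1) by (simp add: dist_norm norm_minus_commute)
    ultimately have "norm (H s t - a) \<le> \<rho> * exp K"
      using \<rho>(1) by (simp add: H_def norm_mult)
    then have "H s t \<in> ball a \<epsilon>" using \<rho>K by (simp add: dist_norm norm_minus_commute)
    moreover have "H s t \<noteq> a"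
      using \<open>norm (circlepath z \<rho> t - z) = \<rho>\<close> \<rho>(1) by (auto simp: H_def)
    ultimately show ?thesis by simp
  qed
  have "homotopic_loops (ball a \<epsilon> - {a}) ((\<lambda>w. a + (w - z) * B w) \<circ> circlepath z \<rho>) (circlepath a \<rho>)"
    unfolding homotopic_loops
  proof (intro exI[where x = "\<lambda>(s, t). H s t"] conjI ballI)
    have "continuous_on ({0..1::real} \<times> {0..1::real}) (\<lambda>x. \<beta> (circlepath z \<rho> (snd x)))"
      by (rule continuous_on_compose2[OF \<beta>(1)])
        (use in_cb in \<open>auto simp: circlepath intro!: continuous_intros\<close>)
    moreover have "continuous_on ({0..1::real} \<times> {0..1::real}) (\<lambda>x. circlepath z \<rho> (snd x))"
      unfolding circlepath by (intro continuous_intros)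
    ultimately show "continuous_on ({0..1::real} \<times> {0..1::real}) (\<lambda>(s, t). H s t)"
      unfolding H_def case_prod_beta by (intro continuous_intros)
    show "(\<lambda>(s, t). H s t) \<in> {0..1} \<times> {0..1} \<rightarrow> ball a \<epsilon> - {a}"
    proof
      fix x :: "real \<times> real" assume "x \<in> {0..1} \<times> {0..1}"
      then show "(case x of (s, t) \<Rightarrow> H s t) \<in> ball a \<epsilon> - {a}"
        using H[of "fst x" "snd x"] by (simp add: case_prod_beta mem_Times_iff)
    qed
  next
    fix x :: real
    show "(case (0, x) of (s, t) \<Rightarrow> H s t) = ((\<lambda>w. a + (w - z) * B w) \<circ> circlepath z \<rho>) x"
      using \<beta>(2)[OF in_cb] by (simp add: H_def)
    show "(case (1, x) of (s, t) \<Rightarrow> H s t) = circlepath a \<rho> x"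
      by (simp add: H_def circlepath)
    show "pathfinish ((\<lambda>(s, t). H s t) \<circ> Pair x) = pathstart ((\<lambda>(s, t). H s t) \<circ> Pair x)"
      by (simp add: pathfinish_def pathstart_def H_def circlepath)
  qed
  then have hl: "homotopic_loops (- {k a}) (k \<circ> ((\<lambda>w. a + (w - z) * B w) \<circ> circlepath z \<rho>)) (k \<circ> circlepath a \<rho>)"
  proof (rule homotopic_loops_continuous_image)
    show "continuous_on (ball a \<epsilon> - {a}) k" by (rule continuous_on_subset[OF k(1)]) auto
    show "k \<in> (ball a \<epsilon> - {a}) \<rightarrow> - {k a}"
      using k(2,3) by (auto simp: inj_on_def)
  qed
  then have "winding_number (k \<circ> (\<lambda>w. a + (w - z) * B w) \<circ> circlepath z \<rho>) (k a) = 1"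
    using winding_number_homotopic_loops[OF hl] w1[OF \<rho>(1) \<rho>\<epsilon>] by (simp only: comp_assoc)
  then show ?thesis using that \<rho> by blast
qed

text \<open>
  A conformal map does not send round circles to round circles around the image of the centre,
  whereas the definition of orientation speaks only of those.  The two preceding lemmas bridge
  the gap: shrink the circle, then straighten its image.
\<close>

lemma orientation_preserving_on_conformal:
  assumes h: "orientation_preserving_on V h" and V: "openin sphere_top V"
    and hc: "continuous_map (subtopology sphere_top V) euclidean h" and hi: "inj_on h V"
    and N: "conformal N" "inj N"
  shows "orientation_preserving_on (N -` V) (h \<circ> N)"
  unfolding orientation_preserving_on_def
proof (intro ballI allI impI, elim conjE)
  fix c z and r :: real
  assume c: "c \<in> charts" and r: "r > 0" and sub: "c ` cball z r \<subseteq> N -` V"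
  obtain c' a B \<delta> where c': "c' \<in> charts" "\<delta> > 0" "continuous_on (cball z \<delta>) B"
      "\<And>w. w \<in> cball z \<delta> \<Longrightarrow> B w \<noteq> 0 \<and> N (c w) = c' (a + (w - z) * B w)"
    using bspec[OF N(1)[unfolded conformal_def] c, THEN spec[of _ z]]
    by (elim bexE exE conjE) (rule that, assumption+, blast)
  \<comment> \<open>Continuity on the sphere is stated for abstract topologies, winding numbers need
     \<open>continuous_on\<close>.\<close>
  have pull: "continuous_on A (h \<circ> g)" if "continuous_map euclidean sphere_top g" "g ` A \<subseteq> V"
    for A and g :: "complex \<Rightarrow> csphere"
  proof -
    have "continuous_map (top_of_set A) (subtopology sphere_top V) g"
      using that by (auto simp: continuous_map_in_subtopology continuous_map_from_subtopology)
    then have "continuous_map (top_of_set A) euclidean (h \<circ> g)"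
      using hc continuous_map_compose by blast
    then show ?thesis by simp
  qed
  have Nc: "N (c z) = c' a" using c'(2) c'(4)[of z] by simp
  have "z \<in> cball z r" using r by simp
  then have "c z \<in> N -` V" using sub by blast
  then have "a \<in> c' -` V" using Nc by auto
  then obtain \<epsilon> where \<epsilon>: "\<epsilon> > 0" "cball a \<epsilon> \<subseteq> c' -` V"
    using open_vimage_chart[OF c'(1) V] open_contains_cball by blast
  have c'V: "c' w \<in> V" if "dist a w \<le> \<epsilon>" for w
    using \<epsilon>(2) that by (auto simp: subset_iff)
  have cV: "N (c w) \<in> V" if "dist z w \<le> r" for w
    using sub that by (auto simp: image_subset_iff)
  have kc: "continuous_on (ball a \<epsilon>) (h \<circ> c')"
    using c'V by (intro pull continuous_map_chart c'(1)) auto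
  have ki: "inj_on (h \<circ> c') (ball a \<epsilon>)"
    using c'V by (intro comp_inj_on inj_on_subset[OF inj_chart[OF c'(1)]] inj_on_subset[OF hi]) auto
  have kw: "winding_number ((h \<circ> c') \<circ> circlepath a \<rho>) ((h \<circ> c') a) = 1" if "0 < \<rho>" "\<rho> < \<epsilon>" for \<rho>
  proof -
    have "c' ` cball a \<rho> \<subseteq> V" using that c'V by auto
    with \<open>0 < \<rho>\<close> have "winding_number (h \<circ> c' \<circ> circlepath a \<rho>) (h (c' a)) = 1"
      using bspec[OF h[unfolded orientation_preserving_on_def] c'(1)] by blast
    then show ?thesis by simp
  qed
  define d where "d = min \<delta> r"
  have d: "d > 0" "cball z d \<subseteq> cball z \<delta>" "d \<le> r" using c'(2) r by (auto simp: d_def)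
  obtain \<rho> where \<rho>: "0 < \<rho>" "\<rho> \<le> d"
    "winding_number ((h \<circ> c') \<circ> (\<lambda>w. a + (w - z) * B w) \<circ> circlepath z \<rho>) ((h \<circ> c') a) = 1"
  proof (rule winding_number_twisted_circle[OF kc ki \<epsilon>(1) kw _ _ d(1)])
    show "continuous_on (cball z d) B" using c'(3) d(2) by (rule continuous_on_subset)
    show "B w \<noteq> 0" if "w \<in> cball z d" for w using c'(4) that d(2) by blast
  qed blast+
  have eq: "(h \<circ> c') \<circ> (\<lambda>w. a + (w - z) * B w) \<circ> circlepath z \<rho> = (h \<circ> N \<circ> c) \<circ> circlepath z \<rho>"
  proof
    fix t
    have "circlepath z \<rho> t \<in> cball z d" using \<rho>(1,2) by (simp add: dist_circlepath)
    then have "circlepath z \<rho> t \<in> cball z \<delta>" using d(2) by blast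
    from c'(4)[OF this] show "((h \<circ> c') \<circ> (\<lambda>w. a + (w - z) * B w) \<circ> circlepath z \<rho>) t = ((h \<circ> N \<circ> c) \<circ> circlepath z \<rho>) t"
      by simp
  qed
  have "continuous_on (cball z r) (h \<circ> (N \<circ> c))"
    using cV conformal_imp_continuous[OF N(1)]
    by (intro pull continuous_map_compose[OF continuous_map_chart[OF c]]) auto
  moreover have "inj_on (h \<circ> (N \<circ> c)) (cball z r)"
    using cV inj_chart[OF c] N(2)
    by (intro comp_inj_on inj_on_subset[OF hi]) (auto simp: inj_on_def)
  ultimately have "winding_number ((h \<circ> (N \<circ> c)) \<circ> circlepath z r) ((h \<circ> (N \<circ> c)) z)
      = winding_number ((h \<circ> (N \<circ> c)) \<circ> circlepath z \<rho>) ((h \<circ> (N \<circ> c)) z)"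
    using \<rho> d by (intro winding_number_circle_radius) auto
  also have "\<dots> = 1" using \<rho>(3) Nc unfolding eq by (simp add: comp_assoc)
  finally show "winding_number (h \<circ> N \<circ> c \<circ> circlepath z r) ((h \<circ> N) (c z)) = 1"
    by (simp add: comp_assoc)
qed

lemma oriented_disc_chart_conformal:
  assumes ch: "oriented_disc_chart x V h" and M: "conformal M" "conformal N"
    and inv: "\<And>x. N (M x) = x" "\<And>x. M (N x) = x"
  shows "oriented_disc_chart (M x) (N -` V) (h \<circ> N)"
proof -
  have V: "openin sphere_top V" "x \<in> V" and hh: "homeomorphic_map (subtopology sphere_top V) (top_of_set (ball 0 1)) h"
    and "h x = 0" and ori: "orientation_preserving_on V h"
    using ch by (auto simp: oriented_disc_chart_def)
  have cN: "continuous_map sphere_top sphere_top N" and cM: "continuous_map sphere_top sphere_top M"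
    using M conformal_imp_continuous by auto
  have op: "openin sphere_top (N -` V)"
  proof -
    have "openin sphere_top {x \<in> topspace sphere_top. N x \<in> V}"
      by (rule openin_continuous_map_preimage[OF cN V(1)])
    moreover have "{x \<in> topspace sphere_top. N x \<in> V} = N -` V"
      unfolding topspace_sphere by auto
    ultimately show ?thesis by simp
  qed
  have "homeomorphic_maps sphere_top sphere_top N M"
    using cN cM inv by (simp add: homeomorphic_maps_def)
  then have "homeomorphic_map sphere_top sphere_top N"
    using homeomorphic_maps_map by blast
  then have "homeomorphic_map (subtopology sphere_top (N -` V)) (subtopology sphere_top V) N"
    by (rule homeomorphic_map_subtopologies_alt)
      (use openin_subset[OF op] openin_subset[OF V(1)] topspace_sphere inv in \<open>auto simp: image_iff\<close>)
  then have hom: "homeomorphic_map (subtopology sphere_top (N -` V)) (top_of_set (ball 0 1)) (h \<circ> N)"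
    using hh homeomorphic_map_compose by blast
  have "continuous_map (subtopology sphere_top V) euclidean h"
    using homeomorphic_imp_continuous_map[OF hh] by (simp add: continuous_map_in_subtopology)
  moreover have "inj_on h V"
    using homeomorphic_imp_injective_map[OF hh] V openin_subset[OF V(1)] topspace_sphere 
    by (simp add: topspace_subtopology inf.absorb2)
  moreover have "inj N" using inv by (metis injI)
  ultimately have "orientation_preserving_on (N -` V) (h \<circ> N)"
    using orientation_preserving_on_conformal[OF ori V(1)] M by blast
  then show ?thesis unfolding oriented_disc_chart_def
    using op hom V \<open>h x = 0\<close> inv by simp
qed

text \<open>
  Only the chart of the target changes: \<open>\<psi>\<close> is replaced by \<open>\<psi> \<circ> N\<close>, where \<open>N\<close> is the inverse
  of \<open>M\<close>.
\<close>

lemma has_local_degree_conformal_compose: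
  assumes "has_local_degree f x d" and M: "conformal M" "conformal N"
    and inv: "\<And>x. N (M x) = x" "\<And>x. M (N x) = x"
  shows "has_local_degree (M \<circ> f) x d"
proof -
  obtain U V \<phi> \<psi> where d: "d \<ge> 1" and ch: "oriented_disc_chart x U \<phi>" "oriented_disc_chart (f x) V \<psi>"
      and sub: "f ` U \<subseteq> V" and pow: "\<forall>y\<in>U. \<psi> (f y) = \<phi> y ^ d"
    using assms(1) unfolding has_local_degree_def by blast
  have "oriented_disc_chart ((M \<circ> f) x) (N -` V) (\<psi> \<circ> N)"
    using oriented_disc_chart_conformal[OF ch(2) M inv] by simp
  moreover have "(M \<circ> f) ` U \<subseteq> N -` V" using sub inv by auto
  moreover have "\<forall>y\<in>U. (\<psi> \<circ> N) ((M \<circ> f) y) = \<phi> y ^ d" using pow inv by simp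
  ultimately show ?thesis unfolding has_local_degree_def using d ch(1) by blast
qed

text \<open>
  Both maps have the same local degrees in the relational sense, so the descriptions defining
  \<open>local_degree\<close> coincide.
\<close>

lemma conformal_compose_invariants:
  assumes M: "conformal M" "conformal N" and inv: "\<And>x. N (M x) = x" "\<And>x. M (N x) = x"
  shows "local_degree (N \<circ> f) = local_degree f"
    and "branched_cover f \<Longrightarrow> branched_cover (N \<circ> f)"
proof -
  have iff: "has_local_degree (N \<circ> f) x d \<longleftrightarrow> has_local_degree f x d" for x d
  proof
    assume "has_local_degree (N \<circ> f) x d"
    then have "has_local_degree (M \<circ> (N \<circ> f)) x d"
      by (rule has_local_degree_conformal_compose[OF _ M inv])
    moreover have "M \<circ> (N \<circ> f) = f" using inv by auto
    ultimately show "has_local_degree f x d" by simp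
  qed (rule has_local_degree_conformal_compose[OF _ M(2,1) inv(2,1)])
  then show "local_degree (N \<circ> f) = local_degree f"
    by (simp add: local_degree_def fun_eq_iff)
  show "branched_cover (N \<circ> f)" if "branched_cover f"
    using that iff conformal_imp_continuous[OF M(2)] continuous_map_compose
    unfolding branched_cover_def by blast
qed

section \<open>Local degrees count nearby preimages\<close>

lemma oriented_disc_chartD:
  assumes "oriented_disc_chart x U h"
  shows "openin sphere_top U" "x \<in> U" "h x = 0" "inj_on h U" "h ` U = ball 0 1"
    "\<And>A. open A \<Longrightarrow> openin sphere_top {y \<in> U. h y \<in> A}"
    "\<And>N. openin sphere_top N \<Longrightarrow> open (h ` (N \<inter> U))"
proof -
  have U: "openin sphere_top U" "x \<in> U" "h x = 0"
    and hh: "homeomorphic_map (subtopology sphere_top U) (top_of_set (ball 0 1)) h"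
    using assms by (auto simp: oriented_disc_chart_def)
  show "openin sphere_top U" "x \<in> U" "h x = 0" by fact+
  have tU: "topspace (subtopology sphere_top U) = U"
    unfolding topspace_subtopology topspace_sphere by simp
  show "inj_on h U" "h ` U = ball 0 1"
    using homeomorphic_imp_injective_map[OF hh] homeomorphic_imp_surjective_map[OF hh] tU by simp_all
  show "openin sphere_top {y \<in> U. h y \<in> A}" if "open A" for A
  proof -
    have "openin (top_of_set (ball 0 1)) (ball 0 1 \<inter> A)" using that by auto
    from openin_continuous_map_preimage[OF homeomorphic_imp_continuous_map[OF hh] this]
    have "openin (subtopology sphere_top U) {y \<in> U. h y \<in> ball 0 1 \<inter> A}" unfolding tU .
    moreover have "{y \<in> U. h y \<in> ball 0 1 \<inter> A} = {y \<in> U. h y \<in> A}"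
      using \<open>h ` U = ball 0 1\<close> by blast
    ultimately show ?thesis using U(1) openin_trans_full by metis
  qed
  show "open (h ` (N \<inter> U))" if "openin sphere_top N" for N
  proof -
    have "openin (subtopology sphere_top U) (N \<inter> U)"
      using that by (rule openin_subtopology_Int)
    then have "openin (top_of_set (ball 0 1)) (h ` (N \<inter> U))"
      using homeomorphic_imp_open_map[OF hh] unfolding open_map_def by blast
    then show ?thesis using openin_open_trans open_ball by blast
  qed
qed

text \<open>
  In the charts the map is \<open>z \<mapsto> z ^ d\<close>, so a point close to, but different from, the value has
  exactly \<open>d\<close> preimages close to \<open>x\<close>, namely the \<open>d\<close>-th roots.  This characterises the local
  degree without reference to charts.
\<close>

lemma has_local_degree_card_nearby:
  assumes "has_local_degree f x d" and N: "openin sphere_top N" "x \<in> N"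
  obtains W Y where "openin sphere_top W" "x \<in> W" "W \<subseteq> N" "openin sphere_top Y" "f x \<in> Y"
    "\<forall>y\<in>Y - {f x}. card {x' \<in> W. f x' = y} = d"
proof -
  obtain U V \<phi> \<psi> where d: "d \<ge> 1" and ch: "oriented_disc_chart x U \<phi>" "oriented_disc_chart (f x) V \<psi>"
      and sub: "f ` U \<subseteq> V" and pow: "\<And>y. y \<in> U \<Longrightarrow> \<psi> (f y) = \<phi> y ^ d"
    using assms(1) unfolding has_local_degree_def by blast
  note U = oriented_disc_chartD[OF ch(1)] and V = oriented_disc_chartD[OF ch(2)]
  have "0 \<in> \<phi> ` (N \<inter> U)" using N(2) U(2,3) by force
  then obtain r where r: "r > 0" "ball 0 r \<subseteq> \<phi> ` (N \<inter> U)"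
    using U(7)[OF N(1)] open_contains_ball by blast
  define W where "W = {y \<in> U. \<phi> y \<in> ball 0 r}"
  define Y where "Y = {y \<in> V. \<psi> y \<in> ball 0 (r ^ d)}"
  have "card {x' \<in> W. f x' = y} = d" if y: "y \<in> Y" "y \<noteq> f x" for y
  proof -
    have yV: "y \<in> V" "norm (\<psi> y) < r ^ d" using y by (auto simp: Y_def)
    have "\<psi> y \<noteq> 0" using inj_onD[OF V(4) _ yV(1) V(2)] y(2) V(3) by auto
    have img: "\<phi> ` {x' \<in> W. f x' = y} = {\<zeta>. \<zeta> ^ d = \<psi> y}"
    proof
      show "\<phi> ` {x' \<in> W. f x' = y} \<subseteq> {\<zeta>. \<zeta> ^ d = \<psi> y}" using pow by (auto simp: W_def)
      show "{\<zeta>. \<zeta> ^ d = \<psi> y} \<subseteq> \<phi> ` {x' \<in> W. f x' = y}"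
      proof clarify
        fix \<zeta> assume \<zeta>: "\<zeta> ^ d = \<psi> y"
        then have "norm \<zeta> ^ d < r ^ d" using yV(2) by (metis norm_power)
        then have "norm \<zeta> < r" using r(1) by (meson power_less_imp_less_base less_imp_le)
        then obtain x' where x': "x' \<in> U" "\<phi> x' = \<zeta>" using r(2) by force
        have "f x' \<in> V" using sub x' by auto
        then have "f x' = y" using inj_onD[OF V(4) _ _ yV(1)] pow x' \<zeta> by auto
        then show "\<zeta> \<in> \<phi> ` {x' \<in> W. f x' = y}" using x' \<open>norm \<zeta> < r\<close> by (auto simp: W_def)
      qed
    qed
    have "inj_on \<phi> {x' \<in> W. f x' = y}"
      by (rule inj_on_subset[OF U(4)]) (auto simp: W_def)
    from card_image[OF this] have "card {x' \<in> W. f x' = y} = card {\<zeta>. \<zeta> ^ d = \<psi> y}"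
      unfolding img by simp
    also have "\<dots> = d" using \<open>\<psi> y \<noteq> 0\<close> d by (intro card_nth_roots) auto
    finally show ?thesis .
  qed
  moreover have "openin sphere_top W" "openin sphere_top Y"
    unfolding W_def Y_def by (intro U(6) V(6) open_ball)+
  moreover have "x \<in> W" "f x \<in> Y" using U V r by (auto simp: W_def Y_def)
  moreover have "W \<subseteq> N"
  proof
    fix w assume "w \<in> W"
    then have w: "w \<in> U" "\<phi> w \<in> \<phi> ` (N \<inter> U)" using r(2) by (auto simp: W_def)
    then obtain w' where "w' \<in> N \<inter> U" "\<phi> w = \<phi> w'" by blast
    then show "w \<in> N" using inj_onD[OF U(4)] w(1) by blast
  qed
  ultimately show ?thesis by (intro that[of W Y] ballI) auto
qed

text \<open>
  Count preimages in two nested neighbourhoods, the outer one for \<open>d\<close> and the inner one for \<open>e\<close>.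
  By symmetry the local degree is unique.
\<close>

lemma has_local_degree_le:
  assumes d: "has_local_degree f x d" and e: "has_local_degree f x e"
  shows "e \<le> d"
proof -
  have UN: "openin sphere_top UNIV" using openin_topspace[of sphere_top] unfolding topspace_sphere .
  obtain W Y where W: "openin sphere_top W" "x \<in> W" "W \<subseteq> UNIV" "openin sphere_top Y" "f x \<in> Y"
    and cW: "\<forall>y\<in>Y - {f x}. card {x' \<in> W. f x' = y} = d"
    by (rule has_local_degree_card_nearby[OF d UN UNIV_I])
  obtain W' Y' where W': "openin sphere_top W'" "x \<in> W'" "W' \<subseteq> W" "openin sphere_top Y'" "f x \<in> Y'"
    and cW': "\<forall>y\<in>Y' - {f x}. card {x' \<in> W'. f x' = y} = e"
    by (rule has_local_degree_card_nearby[OF e W(1,2)])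
  have "infinite (Y \<inter> Y')"
    using W W' by (intro infinite_open_sphere[of _ "f x"]) (auto intro: openin_Int)
  then obtain y where y: "y \<in> Y \<inter> Y'" "y \<noteq> f x"
    by (metis finite.emptyI finite_insert finite_subset insertCI subsetI)
  have "d > 0" using d by (auto simp: has_local_degree_def)
  then have "finite {x' \<in> W. f x' = y}" using bspec[OF cW, of y] y by (intro card_ge_0_finite) auto
  then have "card {x' \<in> W'. f x' = y} \<le> card {x' \<in> W. f x' = y}"
    using W'(3) by (intro card_mono) auto
  then show ?thesis using bspec[OF cW, of y] bspec[OF cW', of y] y by auto
qed

lemma local_degree_eq:
  assumes "has_local_degree f x d" shows "local_degree f x = d"
  unfolding local_degree_def using assms has_local_degree_le by (blast intro: le_antisym)

lemma Hausdorff_separate_finite: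
  assumes X: "Hausdorff_space X" and F: "finite F" "F \<subseteq> topspace X"
  obtains N where "\<And>x. x \<in> F \<Longrightarrow> openin X (N x) \<and> x \<in> N x"
    "\<And>x y. x \<in> F \<Longrightarrow> y \<in> F \<Longrightarrow> x \<noteq> y \<Longrightarrow> N x \<inter> N y = {}"
proof -
  have "\<exists>U V. openin X U \<and> openin X V \<and> x \<in> U \<and> y \<in> V \<and> disjnt U V"
    if "x \<in> F" "y \<in> F" "x \<noteq> y" for x y
  proof -
    have "x \<in> topspace X \<and> y \<in> topspace X \<and> x \<noteq> y" using that F(2) by blast
    then show ?thesis using X[unfolded Hausdorff_space_def] by blast
  qed
  then obtain U V where UV: "\<And>x y. x \<in> F \<Longrightarrow> y \<in> F \<Longrightarrow> x \<noteq> y \<Longrightarrow>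
      openin X (U x y) \<and> openin X (V x y) \<and> x \<in> U x y \<and> y \<in> V x y \<and> disjnt (U x y) (V x y)"
    by metis
  define N where "N x = (\<Inter>y\<in>F - {x}. U x y \<inter> V y x) \<inter> topspace X" for x
  show ?thesis
  proof (rule that[of N])
    show "openin X (N x) \<and> x \<in> N x" if "x \<in> F" for x
      unfolding N_def using UV F that by (auto intro!: openin_INT)
    show "N x \<inter> N y = {}" if "x \<in> F" "y \<in> F" "x \<noteq> y" for x y
      using UV[OF that] that unfolding N_def disjnt_def by blast
  qed
qed

text \<open>
  Every point \<open>z\<close> close to \<open>y\<close> has all its preimages close to the fibre of \<open>y\<close>, since the image
  of the compact complement of a neighbourhood of the fibre is closed and misses \<open>y\<close>.  Near each
  point of the fibre there are as many of them as the local degree.  If all but finitely many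
  fibres have \<open>n\<close> points, some such \<open>z\<close> is generic, and counting its preimages gives the sum.
\<close>

lemma sum_local_degree_fibre:
  assumes f: "branched_cover f" and fin: "finite {x. f x = y}"
    and B: "finite B" "\<And>y. y \<notin> B \<Longrightarrow> card {x. f x = y} = n"
  shows "(\<Sum>x | f x = y. local_degree f x) = n"
proof -
  define F where "F = {x. f x = y}"
  have cont: "continuous_map sphere_top sphere_top f" 
    and deg: "\<And>x. has_local_degree f x (local_degree f x)"
    using f local_degree_eq unfolding branched_cover_def by metis+
  have F: "finite F" "F \<subseteq> topspace sphere_top" using fin topspace_sphere by (auto simp: F_def)
  obtain N where N: "\<And>x. x \<in> F \<Longrightarrow> openin sphere_top (N x) \<and> x \<in> N x"
    "\<And>x y. x \<in> F \<Longrightarrow> y \<in> F \<Longrightarrow> x \<noteq> y \<Longrightarrow> N x \<inter> N y = {}"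
    using Hausdorff_separate_finite[OF Hausdorff_sphere F] by metis
  have "\<forall>x\<in>F. \<exists>P. openin sphere_top (fst P) \<and> x \<in> fst P \<and> fst P \<subseteq> N x \<and>
      openin sphere_top (snd P) \<and> y \<in> snd P \<and>
      (\<forall>z\<in>snd P. z \<noteq> y \<longrightarrow> card {x' \<in> fst P. f x' = z} = local_degree f x)"
  proof
    fix x assume x: "x \<in> F"
    then have "f x = y" by (simp add: F_def)
    have Nx: "openin sphere_top (N x)" "x \<in> N x" using N(1)[OF x] by auto
    obtain W Y where "openin sphere_top W" "x \<in> W" "W \<subseteq> N x" "openin sphere_top Y" "f x \<in> Y"
      "\<forall>y\<in>Y - {f x}. card {x' \<in> W. f x' = y} = local_degree f x"
      by (rule has_local_degree_card_nearby[OF deg[of x] Nx])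
    with \<open>f x = y\<close> show "\<exists>P. openin sphere_top (fst P) \<and> x \<in> fst P \<and> fst P \<subseteq> N x \<and>
      openin sphere_top (snd P) \<and> y \<in> snd P \<and>
      (\<forall>z\<in>snd P. z \<noteq> y \<longrightarrow> card {x' \<in> fst P. f x' = z} = local_degree f x)"
      by (intro exI[of _ "(W, Y)"]) simp
  qed
  from bchoice[OF this] obtain P where P: "\<forall>x\<in>F. openin sphere_top (fst (P x)) \<and>
      x \<in> fst (P x) \<and> fst (P x) \<subseteq> N x \<and> openin sphere_top (snd (P x)) \<and> y \<in> snd (P x) \<and>
      (\<forall>z\<in>snd (P x). z \<noteq> y \<longrightarrow> card {x' \<in> fst (P x). f x' = z} = local_degree f x)"
    by (rule exE)
  define W Y where "W x = fst (P x)" and "Y x = snd (P x)" for x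
  have W: "openin sphere_top (W x) \<and> x \<in> W x \<and> W x \<subseteq> N x"
    and Y: "openin sphere_top (Y x) \<and> y \<in> Y x"
    and card: "\<And>z. z \<in> Y x \<Longrightarrow> z \<noteq> y \<Longrightarrow> card {x' \<in> W x. f x' = z} = local_degree f x"
    if "x \<in> F" for x
    using bspec[OF P that] unfolding W_def Y_def by blast+
  define K where "K = topspace sphere_top - (\<Union>x\<in>F. W x)"
  have "closedin sphere_top K"
    unfolding K_def using W by (intro closedin_diff closedin_topspace openin_Union) auto
  then have "compactin sphere_top K"
    by (simp add: closedin_compact_space)
  then have "closedin sphere_top (f ` K)"
    using cont Hausdorff_sphere by (meson compactin_imp_closedin image_compactin)
  then have "openin sphere_top (topspace sphere_top - f ` K)"
    by (rule openin_diff[OF openin_topspace])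
  then have "openin sphere_top ((\<Inter>x\<in>F. Y x) \<inter> topspace sphere_top \<inter> (topspace sphere_top - f ` K))"
    using Y F(1) by (intro openin_Int openin_INT) auto
  moreover have "y \<in> (\<Inter>x\<in>F. Y x) \<inter> topspace sphere_top \<inter> (topspace sphere_top - f ` K)"
    using Y W unfolding topspace_sphere K_def by (auto simp: F_def)
  ultimately have "infinite ((\<Inter>x\<in>F. Y x) \<inter> topspace sphere_top \<inter> (topspace sphere_top - f ` K))"
    by (rule infinite_open_sphere)
  then have "\<not> (\<Inter>x\<in>F. Y x) \<inter> topspace sphere_top \<inter> (topspace sphere_top - f ` K) \<subseteq> insert y B"
    using B(1) finite_subset by blast
  then obtain z where z: "\<And>x. x \<in> F \<Longrightarrow> z \<in> Y x" "z \<notin> f ` K" "z \<noteq> y" "z \<notin> B"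
    by blast
  have un: "{x. f x = z} = (\<Union>x\<in>F. {x' \<in> W x. f x' = z})"
    using z(2) unfolding K_def topspace_sphere by blast
  have fin: "finite {x' \<in> W x. f x' = z}" if "x \<in> F" for x
  proof (rule card_ge_0_finite)
    have "local_degree f x \<ge> 1" using deg[of x] by (simp add: has_local_degree_def)
    then show "card {x' \<in> W x. f x' = z} > 0" using card[OF that z(1)[OF that] z(3)] by simp
  qed
  have "n = card {x. f x = z}" using B(2)[OF z(4)] by simp
  also have "\<dots> = (\<Sum>x\<in>F. card {x' \<in> W x. f x' = z})"
    unfolding un
  proof (rule card_UN_disjoint[OF F(1)])
    show "\<forall>i\<in>F. \<forall>j\<in>F. i \<noteq> j \<longrightarrow> {x' \<in> W i. f x' = z} \<inter> {x' \<in> W j. f x' = z} = {}"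
      using N(2) W by blast
  qed (use fin in blast)
  also have "\<dots> = (\<Sum>x\<in>F. local_degree f x)"
    using card z by (intro sum.cong) auto
  finally show ?thesis by (simp add: F_def)
qed

section \<open>Fibres of rational maps\<close>

text \<open>
  The finite part of the fibre of \<open>p/q\<close> over \<open>[u : v]\<close> consists of the zeros of this polynomial.
\<close>

definition fibre_poly :: "complex poly \<Rightarrow> complex poly \<Rightarrow> complex \<Rightarrow> complex \<Rightarrow> complex poly"
  where "fibre_poly p q u v = smult v p - smult u q"

lemma rational_fun_eq_hpoint_iff:
  assumes pq: "coprime p q" "q \<noteq> 0" and uv: "u \<noteq> 0 \<or> v \<noteq> 0"
  shows "rational_fun p q (Some z) = hpoint u v \<longleftrightarrow> poly (fibre_poly p q u v) z = 0"
    and "rational_fun p q \<infinity>\<^sub>S = hpoint u v \<longleftrightarrow>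
      coeff (fibre_poly p q u v) (max (degree p) (degree q)) = 0"
proof -
  let ?n = "max (degree p) (degree q)"
  have "poly p z \<noteq> 0 \<or> poly q z \<noteq> 0"
    using coprime_poly_0[OF pq(1)] by blast
  moreover have "rational_fun p q (Some z) = hpoint (poly p z) (poly q z)"
    by (simp add: rational_fun_def hpoint_def)
  ultimately show "rational_fun p q (Some z) = hpoint u v \<longleftrightarrow> poly (fibre_poly p q u v) z = 0"
    using uv by (auto simp: hpoint_eq_iff fibre_poly_def algebra_simps)
  have "coeff p ?n \<noteq> 0 \<or> coeff q ?n \<noteq> 0"
  proof (cases "degree p \<le> degree q")
    case True
    then show ?thesis using pq(2) by (simp add: max_def)
  next
    case False
    then have "p \<noteq> 0" by auto
    then show ?thesis using False by (simp add: max_def)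
  qed
  moreover have "rational_fun p q \<infinity>\<^sub>S = hpoint (coeff p ?n) (coeff q ?n)"
    by (simp add: rational_fun_def hpoint_def Let_def)
  ultimately show "rational_fun p q \<infinity>\<^sub>S = hpoint u v \<longleftrightarrow> coeff (fibre_poly p q u v) ?n = 0"
    using uv by (auto simp: hpoint_eq_iff fibre_poly_def algebra_simps)
qed

lemma degree_fibre_poly_le: "degree (fibre_poly p q u v) \<le> max (degree p) (degree q)"
  unfolding fibre_poly_def by (rule degree_diff_le) (auto simp: degree_smult_le le_max_iff_disj)

lemma fibre_poly_nonzero:
  assumes pq: "coprime p q" "q \<noteq> 0" "max (degree p) (degree q) > 0" and uv: "u \<noteq> 0 \<or> v \<noteq> 0"
  shows "fibre_poly p q u v \<noteq> 0"
proof
  assume "fibre_poly p q u v = 0"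
  then have eq: "smult v p = smult u q" by (simp add: fibre_poly_def)
  then have "v \<noteq> 0" using uv pq(2) by auto
  have "q dvd smult v p" unfolding eq by (simp add: dvd_smult)
  then have "q dvd p" using \<open>v \<noteq> 0\<close> by (simp add: dvd_smult_iff)
  then have "q dvd 1" by (rule coprime_common_divisor[OF pq(1) _ dvd_refl])
  then have "degree q = 0" using pq(2) by (simp add: is_unit_iff_degree)
  moreover have "degree p \<le> degree q"
    using eq \<open>v \<noteq> 0\<close> by (metis degree_smult_eq degree_smult_le)
  ultimately show False using pq(3) by simp
qed

lemma rational_fun_fibre:
  assumes "coprime p q" "q \<noteq> 0" "u \<noteq> 0 \<or> v \<noteq> 0"
  shows "{x. rational_fun p q x = hpoint u v} = Some ` {z. poly (fibre_poly p q u v) z = 0} \<union>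
    (if coeff (fibre_poly p q u v) (max (degree p) (degree q)) = 0 then {\<infinity>\<^sub>S} else {})" (is "?L = ?R")
proof (rule set_eqI)
  fix x show "x \<in> ?L \<longleftrightarrow> x \<in> ?R"
    using rational_fun_eq_hpoint_iff[OF assms] by (cases x) auto
qed

lemma finite_rational_fun_fibre:
  assumes "coprime p q" "q \<noteq> 0" "max (degree p) (degree q) > 0"
  shows "finite {x. rational_fun p q x = y}"
proof -
  obtain u v where uv: "u \<noteq> 0 \<or> v \<noteq> 0" "y = hpoint u v" by (rule hpoint_cases)
  show ?thesis unfolding uv(2) rational_fun_fibre[OF assms(1,2) uv(1)]
    using fibre_poly_nonzero[OF assms uv(1)] by (simp add: poly_roots_finite)
qed

text \<open>
  If \<open>p' q = p q'\<close> with \<open>p\<close> and \<open>q\<close> coprime, then each of \<open>p\<close> and \<open>q\<close> divides its own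
  derivative, which forces both to be constant.
\<close>

lemma wronskian_nonzero:
  fixes p q :: "complex poly"
  assumes pq: "coprime p q" "max (degree p) (degree q) > 0"
  shows "pderiv p * q - p * pderiv q \<noteq> 0"
proof
  assume "pderiv p * q - p * pderiv q = 0"
  then have eq: "pderiv p * q = p * pderiv q" by simp
  have "q dvd p * pderiv q" unfolding eq[symmetric] by simp
  then have q: "q dvd pderiv q"
    using coprime_dvd_mult_right_iff[OF iffD1[OF coprime_commute pq(1)]] by simp
  have "p dvd pderiv p * q" unfolding eq by simp
  then have p: "p dvd pderiv p"
    using coprime_dvd_mult_left_iff[OF pq(1)] by simp
  have "degree q = 0" "degree p = 0"
    using p q not_dvd_pderiv[of p] not_dvd_pderiv[of q] by argo+
  with pq(2) show False by simp
qed

lemma card_roots_rsquarefree: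
  fixes p :: "complex poly"
  assumes "rsquarefree p" shows "card {z. poly p z = 0} = degree p"
proof -
  have p: "p \<noteq> 0" using assms by (simp add: rsquarefree_def)
  have "degree p = size (proots p)" by (rule size_proots_complex[symmetric])
  also have "\<dots> = (\<Sum>z | poly p z = 0. order z p)"
    using p by (simp add: size_multiset_overloaded_eq)
  also have "\<dots> = (\<Sum>z | poly p z = 0. 1)"
    by (rule sum.cong) (use rsquarefree_root_order[OF assms _ p] in auto)
  finally show ?thesis by simp
qed

text \<open>
  A multiple zero \<open>z\<close> of \<open>v p - u q\<close> makes the vectors \<open>(p, q)\<close> and \<open>(p', q')\<close> at \<open>z\<close> parallel,
  so it is a zero of the Wronskian.  The finitely many values taken at such zeros, and the value
  at infinity, are the exceptions.
\<close>

lemma rational_fun_generic_fibre: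
  assumes pq: "coprime p q" "q \<noteq> 0" "max (degree p) (degree q) > 0"
  obtains B where "finite B"
    "\<And>y. y \<notin> B \<Longrightarrow> card {x. rational_fun p q x = y} = max (degree p) (degree q)"
proof -
  let ?n = "max (degree p) (degree q)" and ?f = "rational_fun p q"
  define W where "W = pderiv p * q - p * pderiv q"
  define B where "B = insert (?f \<infinity>\<^sub>S) (?f ` Some ` {z. poly W z = 0})"
  have "finite {z. poly W z = 0}"
    unfolding W_def by (rule poly_roots_finite[OF wronskian_nonzero[OF pq(1,3)]])
  then have "finite B" by (simp add: B_def)
  moreover have "card {x. ?f x = y} = ?n" if "y \<notin> B" for y
  proof -
    obtain u v where uv: "u \<noteq> 0 \<or> v \<noteq> 0" "y = hpoint u v" by (rule hpoint_cases)
    define R where "R = fibre_poly p q u v"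
    have lead: "coeff R ?n \<noteq> 0"
      using that rational_fun_eq_hpoint_iff(2)[OF pq(1,2) uv(1)] uv(2) by (auto simp: B_def R_def)
    have "degree R = ?n"
      by (rule antisym[OF degree_fibre_poly_le[of p q u v, folded R_def] le_degree[OF lead]])
    have "rsquarefree R"
      unfolding rsquarefree_roots
    proof clarify
      fix z assume z: "poly R z = 0" "poly (pderiv R) z = 0"
      have *: "v * poly p z = u * poly q z" "v * poly (pderiv p) z = u * poly (pderiv q) z"
        using z by (simp_all add: R_def fibre_poly_def pderiv_diff pderiv_smult)
      have "v * poly W z = (v * poly (pderiv p) z) * poly q z - (v * poly p z) * poly (pderiv q) z"
        by (simp add: W_def algebra_simps)
      also have "\<dots> = 0" unfolding * by simp
      finally have v0: "v * poly W z = 0" .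
      have "u * poly W z = poly (pderiv p) z * (u * poly q z) - poly p z * (u * poly (pderiv q) z)"
        by (simp add: W_def algebra_simps)
      also have "\<dots> = 0" unfolding *[symmetric] by simp
      finally have "u * poly W z = 0" .
      with v0 have "poly W z = 0" using uv(1) by auto
      moreover have "?f (Some z) = y"
        using rational_fun_eq_hpoint_iff(1)[OF pq(1,2) uv(1)] z(1) uv(2) by (simp add: R_def)
      ultimately show False using that by (auto simp: B_def)
    qed
    then have "card {z. poly R z = 0} = ?n"
      using card_roots_rsquarefree \<open>degree R = ?n\<close> by simp
    then show ?thesis
      unfolding uv(2) rational_fun_fibre[OF pq(1,2) uv(1)] R_def[symmetric]
      using lead by (simp add: card_image)
  qed
  ultimately show ?thesis using that by blast
qed

section \<open>Critical values of quadratic rational maps\<close>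

text \<open>
  The two zeros are points of the projective line; when \<open>C\<close> vanishes, one of them is infinity.
\<close>

lemma quadratic_form_distinct_zeros:
  fixes A B C :: complex
  assumes "B\<^sup>2 - 4 * A * C \<noteq> 0"
  obtains u v u' v' where "u \<noteq> 0 \<or> v \<noteq> 0" "u' \<noteq> 0 \<or> v' \<noteq> 0" "u * v' \<noteq> u' * v"
    "C * u\<^sup>2 + B * u * v + A * v\<^sup>2 = 0" "C * u'\<^sup>2 + B * u' * v' + A * v'\<^sup>2 = 0"
proof (cases "C = 0")
  case True
  then have "B \<noteq> 0" using assms by auto
  show ?thesis
    by (rule that[of 1 0 "- A" B]) (use True \<open>B \<noteq> 0\<close> in \<open>auto simp: power2_eq_square\<close>)
next
  case False
  define s where "s = csqrt (B\<^sup>2 - 4 * A * C)"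
  have s: "s\<^sup>2 = B\<^sup>2 - 4 * A * C" "s \<noteq> 0" using assms by (auto simp: s_def)
  have zero: "C * (- B + t)\<^sup>2 + B * (- B + t) * (2 * C) + A * (2 * C)\<^sup>2 = 0" if "t\<^sup>2 = s\<^sup>2" for t
  proof -
    have "C * (- B + t)\<^sup>2 + B * (- B + t) * (2 * C) + A * (2 * C)\<^sup>2 = C * (t\<^sup>2 - (B\<^sup>2 - 4 * A * C))"
      by (simp add: power2_eq_square algebra_simps)
    then show ?thesis using that s by simp
  qed
  have "(- B + s) * (2 * C) - (- B + - s) * (2 * C) = 4 * s * C" by (simp add: algebra_simps)
  then have "(- B + s) * (2 * C) \<noteq> (- B + - s) * (2 * C)" using s(2) False by auto
  then show ?thesis
    using zero[of s] zero[of "- s"] False by (intro that[of "- B + s" "2 * C" "- B + - s" "2 * C"]) auto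
qed

lemma degree_2_form:
  fixes p :: "'a::comm_ring_1 poly"
  assumes "degree p \<le> 2"
  shows "p = [:coeff p 0, coeff p 1, coeff p 2:]"
proof (rule poly_eqI)
  fix n :: nat
  consider "n = 0" | "n = 1" | "n = 2" | "n > 2" by linarith
  then show "coeff p n = coeff [:coeff p 0, coeff p 1, coeff p 2:] n"
    using assms by cases (auto simp: coeff_pCons numeral_2_eq_2 coeff_eq_0 split: nat.splits)
qed

text \<open>
  This is the resultant of \<open>p\<close> and \<open>q\<close> as binary quadratic forms.  In terms of the minors
  \<open>l, m, n\<close> of the coefficient matrix it is \<open>m\<^sup>2 - l n\<close>.  If it vanishes, then at \<open>z = - m / n\<close>
  (or at infinity, when \<open>n = 0\<close>) the value vector \<open>(p, q)\<close> is parallel to all three coefficient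
  pairs; so \<open>p\<close> and \<open>q\<close> are proportional, contradicting coprimality.
\<close>

lemma resultant_nonzero:
  fixes p q :: "complex poly"
  assumes pq: "coprime p q" "q \<noteq> 0" "max (degree p) (degree q) = 2"
  defines "a \<equiv> coeff p" and "b \<equiv> coeff q"
  shows "(a 2 * b 0 - a 0 * b 2)\<^sup>2 - (a 1 * b 0 - a 0 * b 1) * (a 2 * b 1 - a 1 * b 2) \<noteq> 0"
proof
  assume res: "(a 2 * b 0 - a 0 * b 2)\<^sup>2 - (a 1 * b 0 - a 0 * b 1) * (a 2 * b 1 - a 1 * b 2) = 0"
  have pf: "p = [:a 0, a 1, a 2:]" and qf: "q = [:b 0, b 1, b 2:]"
    using degree_2_form[of p] degree_2_form[of q] pq(3) by (auto simp: a_def b_def)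
  have False if uv: "u \<noteq> 0 \<or> v \<noteq> 0" and i: "v * a 0 = u * b 0" "v * a 1 = u * b 1" "v * a 2 = u * b 2" for u v
  proof -
    have "fibre_poly p q u v = 0"
      unfolding fibre_poly_def pf qf using i by simp
    then show False using fibre_poly_nonzero[OF pq(1,2) _ uv] pq(3) by simp
  qed note no_ratio = this
  define l where "l = a 1 * b 0 - a 0 * b 1"
  define m where "m = a 2 * b 0 - a 0 * b 2"
  define n where "n = a 2 * b 1 - a 1 * b 2"
  have res': "m * m = l * n" using res by (simp add: l_def m_def n_def power2_eq_square)
  show False
  proof (cases "n = 0")
    case True
    then have "m = 0" using res' by simp
    have "a 2 \<noteq> 0 \<or> b 2 \<noteq> 0"
    proof (rule ccontr)
      assume "\<not> ?thesis"
      then have "degree p \<le> 1" "degree q \<le> 1" by (subst pf qf, simp)+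
      then show False using pq(3) by simp
    qed
    then show False using no_ratio[of "a 2" "b 2"] True \<open>m = 0\<close>
      by (simp add: m_def n_def mult.commute)
  next
    case False
    define z where "z = - m / n"
    have z: "n * z = - m" using False by (simp add: z_def)
    have mz: "l + m * z = 0"
    proof -
      have "n * (l + m * z) = l * n + m * (n * z)" by (simp add: algebra_simps)
      then show ?thesis using res' z False by simp
    qed
    have nz: "n * z * z = l"
    proof -
      have "n * z * z = - (m * z)" using z by simp
      also have "\<dots> = l" using mz by (metis add_eq_0_iff2)
      finally show ?thesis .
    qed
    have "b 2 * poly p z - a 2 * poly q z = - (n * z + m)"
         "b 0 * poly p z - a 0 * poly q z = z * (l + m * z)"
         "b 1 * poly p z - a 1 * poly q z = n * z * z - l"
      unfolding pf qf l_def m_def n_def by (simp_all add: algebra_simps)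
    then have "b 2 * poly p z = a 2 * poly q z" "b 0 * poly p z = a 0 * poly q z"
         "b 1 * poly p z = a 1 * poly q z"
      using z mz nz by simp_all
    moreover have "poly p z \<noteq> 0 \<or> poly q z \<noteq> 0" using coprime_poly_0[OF pq(1)] by blast
    ultimately show False using no_ratio[of "poly p z" "poly q z"] by (simp add: mult.commute)
  qed
qed

text \<open>
  The fibre polynomial has degree at most 2 and zero discriminant: it has either one double zero
  or no finite zero at all, and in the latter case the fibre is infinity alone.
\<close>

lemma card_fibre_of_discriminant_zero:
  fixes p q :: "complex poly"
  assumes pq: "coprime p q" "q \<noteq> 0" "max (degree p) (degree q) = 2" and uv: "u \<noteq> 0 \<or> v \<noteq> 0"
    and disc: "(v * coeff p 1 - u * coeff q 1)\<^sup>2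
      = 4 * (v * coeff p 0 - u * coeff q 0) * (v * coeff p 2 - u * coeff q 2)"
  shows "card {x. rational_fun p q x = hpoint u v} = 1"
proof -
  define R where "R = fibre_poly p q u v"
  define r where "r = coeff R"
  have R0: "R \<noteq> 0" using fibre_poly_nonzero[OF pq(1,2) _ uv] pq(3) by (simp add: R_def)
  have Rf: "R = [:r 0, r 1, r 2:]"
    using degree_2_form[of R] degree_fibre_poly_le[of p q u v] pq(3) by (simp add: R_def r_def)
  have disc': "(r 1)\<^sup>2 = 4 * r 0 * r 2" using disc by (simp add: r_def R_def fibre_poly_def)
  have fib: "{x. rational_fun p q x = hpoint u v} =
      Some ` {z. poly R z = 0} \<union> (if r 2 = 0 then {\<infinity>\<^sub>S} else {})"
    using rational_fun_fibre[OF pq(1,2) uv] pq(3) by (simp add: R_def r_def)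
  show ?thesis
  proof (cases "r 2 = 0")
    case True
    then have "r 1 = 0" using disc' by simp
    with True have "R = [:r 0:]" "r 0 \<noteq> 0" using Rf R0 by auto
    then have "{z. poly R z = 0} = {}" by simp
    then show ?thesis using True fib by simp
  next
    case False
    have sq: "4 * r 2 * poly R z = (2 * r 2 * z + r 1)\<^sup>2" for z
    proof -
      have "4 * r 2 * poly R z = (2 * r 2 * z + r 1)\<^sup>2 - ((r 1)\<^sup>2 - 4 * r 0 * r 2)"
        by (subst Rf) (simp add: power2_eq_square algebra_simps)
      then show ?thesis using disc' by simp
    qed
    have "poly R z = 0 \<longleftrightarrow> z = - r 1 / (2 * r 2)" for z
    proof -
      have "poly R z = 0 \<longleftrightarrow> 4 * r 2 * poly R z = 0" using False by simp
      also have "\<dots> \<longleftrightarrow> 2 * r 2 * z + r 1 = 0" unfolding sq by simp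
      also have "\<dots> \<longleftrightarrow> 2 * r 2 * z = - r 1" by (rule eq_neg_iff_add_eq_0[symmetric])
      also have "\<dots> \<longleftrightarrow> z = - r 1 / (2 * r 2)" 
        using False by (subst nonzero_eq_divide_eq) (simp_all add: mult.commute)
      finally show ?thesis .
    qed
    then have "{z. poly R z = 0} = {- r 1 / (2 * r 2)}" by blast
    then show ?thesis using False fib by simp
  qed
qed

text \<open>
  The discriminant of \<open>v p - u q\<close> is a binary quadratic form in \<open>(u, v)\<close>, whose own discriminant
  is 16 times the resultant of \<open>p\<close> and \<open>q\<close>.  It therefore has two distinct projective zeros, the
  two critical values of \<open>p/q\<close>.
\<close>

lemma quadratic_rational_singleton_fibres:
  assumes pq: "coprime p q" "q \<noteq> 0" "max (degree p) (degree q) = 2"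
  obtains y y' where "y \<noteq> y'" "card {x. rational_fun p q x = y} = 1"
    "card {x. rational_fun p q x = y'} = 1"
proof -
  define a b where "a = coeff p" and "b = coeff q"
  define A where "A = (a 1)\<^sup>2 - 4 * a 0 * a 2"
  define B where "B = 4 * (a 2 * b 0 + a 0 * b 2) - 2 * a 1 * b 1"
  define C where "C = (b 1)\<^sup>2 - 4 * b 0 * b 2"
  have "B\<^sup>2 - 4 * A * C =
      16 * ((a 2 * b 0 - a 0 * b 2)\<^sup>2 - (a 1 * b 0 - a 0 * b 1) * (a 2 * b 1 - a 1 * b 2))"
    unfolding A_def B_def C_def by (simp add: power2_eq_square algebra_simps)
  then have "B\<^sup>2 - 4 * A * C \<noteq> 0" using resultant_nonzero[OF pq] by (simp add: a_def b_def)
  then obtain u v u' v' where uv: "u \<noteq> 0 \<or> v \<noteq> 0" "u' \<noteq> 0 \<or> v' \<noteq> 0" "u * v' \<noteq> u' * v"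
    and zero: "C * u\<^sup>2 + B * u * v + A * v\<^sup>2 = 0" "C * u'\<^sup>2 + B * u' * v' + A * v'\<^sup>2 = 0"
    by (rule quadratic_form_distinct_zeros)
  have disc: "(v * a 1 - u * b 1)\<^sup>2 = 4 * (v * a 0 - u * b 0) * (v * a 2 - u * b 2)"
    if "C * u\<^sup>2 + B * u * v + A * v\<^sup>2 = 0" for u v
  proof -
    have "(v * a 1 - u * b 1)\<^sup>2 - 4 * (v * a 0 - u * b 0) * (v * a 2 - u * b 2)
        = C * u\<^sup>2 + B * u * v + A * v\<^sup>2"
      unfolding A_def B_def C_def by (simp add: power2_eq_square algebra_simps)
    then show ?thesis using that by simp
  qed
  show ?thesis
  proof (rule that[of "hpoint u v" "hpoint u' v'"])
    show "hpoint u v \<noteq> hpoint u' v'" using hpoint_eq_iff[OF uv(1,2)] uv(3) by simp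
  qed (use card_fibre_of_discriminant_zero[OF pq] uv disc[OF zero(1)] disc[OF zero(2)]
      in \<open>simp_all add: a_def b_def\<close>)
qed

section \<open>The Moebius transformations exchanging four points in pairs\<close>

text \<open>
  The values at 0, 1 and infinity give three equations between the coefficients, and these are
  the three coefficients of the identity \<open>(az + b)(c'z + d') = (a'z + b')(cz + d)\<close>.
\<close>

lemma moebius_eqI:
  assumes "moebius M" "moebius N"
    and eq: "M (Some 0) = N (Some 0)" "M (Some 1) = N (Some 1)" "M \<infinity>\<^sub>S = N \<infinity>\<^sub>S"
  shows "M = N"
proof
  fix x
  obtain a b c d where M: "a * d - b * c \<noteq> 0" "M = mob a b c d"
    using assms(1) moebius_iff_mob by blast
  obtain a' b' c' d' where N: "a' * d' - b' * c' \<noteq> 0" "N = mob a' b' c' d'"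
    using assms(2) moebius_iff_mob by blast
  have iff: "M (hpoint u v) = N (hpoint u v) \<longleftrightarrow>
      (a * u + b * v) * (c' * u + d' * v) = (a' * u + b' * v) * (c * u + d * v)"
    if uv: "u \<noteq> 0 \<or> v \<noteq> 0" for u v
    unfolding M(2) N(2) mob_hpoint[OF M(1) uv] mob_hpoint[OF N(1) uv]
    by (rule hpoint_eq_iff[OF linear_nonzero[OF M(1) uv] linear_nonzero[OF N(1) uv]])
  have "b * d' = b' * d" using eq(1) iff[of 0 1] by (simp add: hpoint_def)
  moreover have "a * c' = a' * c" using eq(3) iff[of 1 0] by (simp add: hpoint_def)
  moreover have "(a + b) * (c' + d') = (a' + b') * (c + d)"
    using eq(2) iff[of 1 1] by (simp add: hpoint_def)
  ultimately have co: "b * d' = b' * d" "a * c' = a' * c" "a * d' + b * c' = a' * d + b' * c"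
    by (simp_all add: algebra_simps)
  obtain u v where uv: "u \<noteq> 0 \<or> v \<noteq> 0" "x = hpoint u v" by (rule hpoint_cases)
  have "(a * u + b * v) * (c' * u + d' * v) = (a * c') * u\<^sup>2 + (a * d' + b * c') * (u * v) + (b * d') * v\<^sup>2"
    by (simp add: algebra_simps power2_eq_square)
  also have "\<dots> = (a' * u + b' * v) * (c * u + d * v)"
    unfolding co by (simp add: algebra_simps power2_eq_square)
  finally show "M x = N x" using iff[OF uv(1)] uv(2) by simp
qed

lemma moebius_double_swap_eq:
  assumes "moebius M" "M a = b" "M b = a" "M c = d" "M d = c"
    and "{Some 0, Some 1, \<infinity>\<^sub>S} \<subseteq> {a, b, c, d}"
  shows "moebius_double_swap a b c d = M"
  unfolding moebius_double_swap_def
proof (rule the_equality)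
  fix N assume N: "moebius N \<and> N a = b \<and> N b = a \<and> N c = d \<and> N d = c"
  have "N x = M x" if "x \<in> {a, b, c, d}" for x using that N assms by auto
  then show "N = M" using assms(1,6) N by (intro moebius_eqI) auto
qed (use assms in auto)

text \<open>
  With \<open>p = t\<close>, the three transformations are \<open>(z - t)/(z - 1)\<close>, \<open>t/z\<close> and
  \<open>t(z - 1)/(z - t)\<close>.
\<close>

lemma moebius_M_double_swap:
  assumes p: "p \<notin> {Some 0, Some 1, \<infinity>\<^sub>S}" and w: "w \<in> {Some 0, Some 1, \<infinity>\<^sub>S}"
  defines "M \<equiv> moebius_M p w"
  shows "moebius M" "M p = w"
    "\<And>x. x \<in> {Some 0, Some 1, \<infinity>\<^sub>S, p} \<Longrightarrow> M x \<in> {Some 0, Some 1, \<infinity>\<^sub>S, p} \<and> M (M x) = x"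
proof -
  obtain t where t: "p = Some t" "t \<noteq> 0" "t \<noteq> 1" using p by (cases p) auto
  have mob: "moebius (mob a b c d)" if "a * d - b * c \<noteq> 0" for a b c d
    using that moebius_iff_mob by blast
  consider "w = Some 0" | "w = Some 1" | "w = \<infinity>\<^sub>S" using w by blast
  then have swap: "moebius M \<and> M p = w \<and> (\<forall>x\<in>{Some 0, Some 1, \<infinity>\<^sub>S, p}.
      M x \<in> {Some 0, Some 1, \<infinity>\<^sub>S, p} \<and> M (M x) = x)"
  proof cases
    case 1
    define N where "N = mob 1 (- t) 1 (- 1)"
    have N: "moebius N" unfolding N_def using t by (intro mob) simp
    have v: "N p = Some 0" "N (Some 0) = p" "N (Some 1) = \<infinity>\<^sub>S" "N \<infinity>\<^sub>S = Some 1"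
      using t by (simp_all add: N_def mob_def hpoint_def)
    have "M = N" unfolding M_def moebius_M_def using N v 1
      by (simp add: moebius_double_swap_eq)
    then show ?thesis using N v 1 by simp
  next
    case 2
    define N where "N = mob 0 t 1 0"
    have N: "moebius N" unfolding N_def using t by (intro mob) simp
    have v: "N p = Some 1" "N (Some 1) = p" "N (Some 0) = \<infinity>\<^sub>S" "N \<infinity>\<^sub>S = Some 0"
      using t by (simp_all add: N_def mob_def hpoint_def)
    have "M = N" unfolding M_def moebius_M_def using N v 2
      by (simp add: moebius_double_swap_eq)
    then show ?thesis using N v 2 by simp
  next
    case 3
    define N where "N = mob t (- t) 1 (- t)"
    have "t * - t - - t * 1 = t * (1 - t)" by (simp add: algebra_simps)
    then have N: "moebius N" unfolding N_def using t by (intro mob) simp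
    have v: "N p = \<infinity>\<^sub>S" "N \<infinity>\<^sub>S = p" "N (Some 0) = Some 1" "N (Some 1) = Some 0"
      using t by (simp_all add: N_def mob_def hpoint_def)
    have "M = N" unfolding M_def moebius_M_def using N v 3
      by (simp add: moebius_double_swap_eq)
    then show ?thesis using N v 3 by simp
  qed
  show "moebius M" by (rule swap[THEN conjunct1])
  show "M p = w" by (rule swap[THEN conjunct2, THEN conjunct1])
  show "M x \<in> {Some 0, Some 1, \<infinity>\<^sub>S, p} \<and> M (M x) = x" if "x \<in> {Some 0, Some 1, \<infinity>\<^sub>S, p}" for x
    by (rule bspec[OF swap[THEN conjunct2, THEN conjunct2] that])
qed

section \<open>Removing a statically trivial point from the postcritical set\<close>

lemma critical_value_postcritical: "c \<in> critical_points f \<Longrightarrow> f c \<in> postcritical_set f"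
  unfolding postcritical_set_def by (intro UN_I[of 1]) auto

lemma postcritical_set_image:
  assumes "x \<in> postcritical_set f" shows "f x \<in> postcritical_set f"
proof -
  obtain i c where i: "i > 0" "c \<in> critical_points f" "x = (f ^^ i) c"
    using assms unfolding postcritical_set_def by blast
  then have "f x = (f ^^ Suc i) c" by simp
  then show ?thesis using i(2) unfolding postcritical_set_def by blast
qed

lemma postcritical_set_subset:
  assumes "\<And>c. c \<in> critical_points f \<Longrightarrow> f c \<in> A" "\<And>x. x \<in> A \<Longrightarrow> f x \<in> A"
  shows "postcritical_set f \<subseteq> A"
proof -
  have "(f ^^ Suc i) c \<in> A" if "c \<in> critical_points f" for i c
    by (induction i) (use assms that in auto)
  then show ?thesis unfolding postcritical_set_def by (auto simp: gr0_conv_Suc)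
qed

lemma cover_degree_eqI:
  assumes "\<And>y. (\<Sum>x | f x = y. local_degree f x) = d" shows "cover_degree f = d"
  unfolding cover_degree_def using assms by (intro the_equality) auto

lemma sum_local_degree_rational_fun:
  assumes "coprime p q" "q \<noteq> 0" "max (degree p) (degree q) > 0" "branched_cover (rational_fun p q)"
  shows "(\<Sum>x | rational_fun p q x = y. local_degree (rational_fun p q) x) = max (degree p) (degree q)"
proof -
  obtain B where "finite B"
    "\<And>y. y \<notin> B \<Longrightarrow> card {x. rational_fun p q x = y} = max (degree p) (degree q)"
    using rational_fun_generic_fibre[OF assms(1-3)] by blast
  then show ?thesis
    using sum_local_degree_fibre[OF assms(4) finite_rational_fun_fibre[OF assms(1-3)]] by blast
qed

lemma rational_fun_degree_0:
  assumes "max (degree p) (degree q) = 0" shows "rational_fun p q x = rational_fun p q \<infinity>\<^sub>S"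
proof -
  have "degree p = 0" "degree q = 0" using assms by simp_all
  then obtain a b where "p = [:a:]" "q = [:b:]" by (metis degree_eq_zeroE)
  then show ?thesis by (cases x) (simp_all add: rational_fun_def)
qed

text \<open>
  The topological degree 2 is the algebraic degree, because the local degrees in every fibre add
  up to the latter.  A fibre with a single point then consists of a critical point, so the two
  singleton fibres provide distinct critical values.  The assumptions on the postcritical set
  exclude constant maps.
\<close>

lemma quadratic_rational_fibres_and_critical_values:
  assumes "rational_map f" "quadratic_thurston_map f" "postcritical_set f \<noteq> {}"
    "\<And>k. postcritical_set f \<noteq> {k}"
  shows "(\<Sum>x | f x = y. local_degree f x) = 2"
    and "\<exists>c\<in>critical_points f. \<exists>c'\<in>critical_points f. f c \<noteq> f c'"
proof -
  obtain p q where pq: "q \<noteq> 0" "coprime p q" "f = rational_fun p q"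
    using assms(1) unfolding rational_map_def by blast
  have bc: "branched_cover f" and deg: "cover_degree f = 2"
    using assms(2) by (auto simp: quadratic_thurston_map_def thurston_map_def)
  have pos: "max (degree p) (degree q) > 0"
  proof (rule ccontr)
    assume "\<not> ?thesis"
    then have "f x = f \<infinity>\<^sub>S" for x unfolding pq(3) using rational_fun_degree_0[of p q x] by simp
    then have "postcritical_set f \<subseteq> {f \<infinity>\<^sub>S}" by (intro postcritical_set_subset) auto
    then show False using assms(3,4) by blast
  qed
  have sum: "(\<Sum>x | f x = y. local_degree f x) = max (degree p) (degree q)" for y
    using sum_local_degree_rational_fun[OF pq(2,1) pos] bc pq(3) by simp
  then have two: "max (degree p) (degree q) = 2" using cover_degree_eqI[of f] deg by metis
  show "(\<Sum>x | f x = y. local_degree f x) = 2" using sum two by simp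
  obtain y y' where y: "y \<noteq> y'" "card {x. f x = y} = 1" "card {x. f x = y'} = 1"
    using quadratic_rational_singleton_fibres[OF pq(2,1) two] pq(3) by metis
  have crit: "\<exists>c\<in>critical_points f. f c = y" if one: "card {x. f x = y} = 1" for y
  proof -
    obtain c where c: "{x. f x = y} = {c}" using one by (rule card_1_singletonE)
    then have "local_degree f c = 2" using sum[of y] two by simp
    moreover have "f c = y" using c by blast
    ultimately show ?thesis by (intro bexI[of _ c]) (simp_all add: critical_points_def)
  qed
  show "\<exists>c\<in>critical_points f. \<exists>c'\<in>critical_points f. f c \<noteq> f c'"
    using crit[OF y(2)] crit[OF y(3)] y(1) by metis
qed

theorem proposition3p2:
  fixes f :: "csphere \<Rightarrow> csphere" and p :: csphere
  assumes "rational_map f"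
    and "quadratic_thurston_map f"
    and "\<not> euclidean_thurston_map f"
    and "card (postcritical_set f) = 4"
    and "postcritical_set f = {Some 0, Some 1, \<infinity>\<^sub>S, p}"
    and "statically_trivial f p"
  shows "\<exists>g. quadratic_thurston_map g \<and>
           (card (postcritical_set g) = 2 \<or> card (postcritical_set g) = 3) \<and>
           f = moebius_M p (f p) \<circ> g"
proof -
  define S where "S = {Some 0, Some 1, \<infinity>\<^sub>S, p}"
  have P: "postcritical_set f = S" using assms(5) by (simp add: S_def)
  have p: "p \<notin> {Some 0, Some 1, \<infinity>\<^sub>S}"
  proof
    assume "p \<in> {Some 0, Some 1, \<infinity>\<^sub>S}"
    then have "postcritical_set f = {Some 0, Some 1, \<infinity>\<^sub>S}" unfolding assms(5) by blast
    then show False using assms(4) by simp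
  qed
  have no_crit: "f c \<noteq> f p" if "c \<in> critical_points f" for c
    using assms(6) that unfolding statically_trivial_def by auto
  have only_p: "x = p" if "x \<in> S" "f x = f p" for x
    using assms(6) that P unfolding statically_trivial_def by auto
  \<comment> \<open>Otherwise \<open>p\<close> could only be reached from \<open>p\<close> itself and would not be postcritical.\<close>
  have "f p \<noteq> p"
  proof
    assume fix_p: "f p = p"
    have "postcritical_set f \<subseteq> S - {p}"
      using no_crit only_p critical_value_postcritical[of _ f] postcritical_set_image[of _ f] P fix_p
      by (intro postcritical_set_subset) auto
    then show False using P by (auto simp: S_def)
  qed
  moreover have "f p \<in> S" using postcritical_set_image[of p f] P by (simp add: S_def)
  ultimately have w: "f p \<in> {Some 0, Some 1, \<infinity>\<^sub>S}" by (auto simp: S_def)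
  define M where "M = moebius_M p (f p)"
  have M: "moebius M" "M p = f p" and MS: "\<And>x. x \<in> S \<Longrightarrow> M x \<in> S \<and> M (M x) = x"
    unfolding M_def S_def by (fact moebius_M_double_swap[OF p w])+
  obtain N where N: "conformal M" "conformal N" "\<And>x. N (M x) = x" "\<And>x. M (N x) = x"
    using moebius_conformal_inverse[OF M(1)] by metis
  \<comment> \<open>On \<open>S\<close> the map \<open>M\<close> is an involution, so it agrees there with its inverse \<open>N\<close>.\<close>
  have NS: "N x \<in> S" if "x \<in> S" for x using MS[OF that] N(3) by metis
  define g where "g = N \<circ> f"
  have "postcritical_set f \<noteq> {}" "postcritical_set f \<noteq> {k}" for k
    using assms(4) by auto
  note quad = quadratic_rational_fibres_and_critical_values[OF assms(1,2) this]
  note ld = conformal_compose_invariants[OF N, of f, folded g_def]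
  have crit: "critical_points g = critical_points f" by (simp add: critical_points_def ld)
  have gp: "f x = f p" if "g x = p" for x
    using that N(4)[of "f x"] M(2) by (simp add: g_def)
  \<comment> \<open>The map \<open>N\<close> takes the value \<open>p\<close> only at \<open>f p\<close>.\<close>
  have avoid: "g x \<in> S - {p}" if "f x \<in> S" "f x \<noteq> f p" for x
    using NS[OF that(1)] gp[of x] that(2) unfolding g_def by auto
  have "postcritical_set g \<subseteq> S - {p}"
  proof (rule postcritical_set_subset)
    fix c assume "c \<in> critical_points g"
    then have c: "c \<in> critical_points f" unfolding crit .
    show "g c \<in> S - {p}"
      using avoid critical_value_postcritical[OF c] no_crit[OF c] unfolding P by blast
  next
    fix x assume x: "x \<in> S - {p}"
    then have "f x \<in> S" using postcritical_set_image[of x f] unfolding P by blast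
    moreover have "f x \<noteq> f p" using only_p[of x] x by blast
    ultimately show "g x \<in> S - {p}" by (rule avoid)
  qed
  then have sub: "postcritical_set g \<subseteq> {Some 0, Some 1, \<infinity>\<^sub>S}" by (auto simp: S_def)
  then have fin: "finite (postcritical_set g)" by (rule finite_subset) simp
  have "card (postcritical_set g) \<le> 3"
    using card_mono[OF _ sub] by simp
  moreover obtain c c' where c: "c \<in> critical_points f" "c' \<in> critical_points f" "f c \<noteq> f c'"
    using quad(2) by blast
  have "g c \<noteq> g c'" using c(3) N(4)[of "f c"] N(4)[of "f c'"] by (auto simp: g_def)
  moreover have "{g c, g c'} \<subseteq> postcritical_set g"
    using critical_value_postcritical[of _ g] c(1,2) unfolding crit by simp
  ultimately have card: "card (postcritical_set g) = 2 \<or> card (postcritical_set g) = 3"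
    using card_mono[OF fin, of "{g c, g c'}"] by auto
  have "(\<Sum>x | g x = y. local_degree g x) = 2" for y
  proof -
    have "{x. g x = y} = {x. f x = M y}" using N(3,4) by (auto simp: g_def)
    then show ?thesis using quad(1)[of "M y"] ld(1) by simp
  qed
  then have "cover_degree g = 2" by (rule cover_degree_eqI)
  moreover have "branched_cover g"
    using ld(2) assms(2) by (auto simp: quadratic_thurston_map_def thurston_map_def)
  ultimately have "quadratic_thurston_map g"
    using fin by (simp add: quadratic_thurston_map_def thurston_map_def)
  moreover have "f = M \<circ> g" using N(4) by (auto simp: g_def)
  ultimately show ?thesis using card unfolding M_def by blast
qed

end
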